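(* Let $\mathcal{A} : \mathbb{R}^d \to \mathbb{C}^{n\times n}$ be a Hermitian and analytic matrix-valued function. Then $$\lambda_{\max}\left[\nabla^2\lambda_{\min}(\mathcal{A}(\omega))\right] \;\le\; \lambda_{\max}\left(\nabla^2\mathcal{A}(\omega)\right)$$ for all $\omega\in\mathbb{R}^d$ such that $\lambda_{\min}(\mathcal{A}(\omega))$ is simple, where $\nabla^2\mathcal{A}(\omega)\in\mathbb{C}^{nd\times nd}$ is the $d\times d$ block matrix whose $(k,\ell)$ block, for $k,\ell=1,\dots,d$, is the $n\times n$ matrix $\dfrac{\partial^2\mathcal{A}(\omega)}{\partial\omega_k\,\partial\omega_\ell}$.
   Context: $\lambda_{\min}(\cdot)$ and $\lambda_{\max}(\cdot)$ denote the smallest and largest eigenvalue of a Hermitian matrix. Analytic means real-analytic. The function $\omega\mapsto\lambda_{\min}(\mathcal{A}(\omega))$ is twice continuously differentiable wherever this eigenvalue is simple, and $\nabla^2\lambda_{\min}(\mathcal{A}(\omega))\in\mathbb{R}^{d\times d}$ denotes its Hessian. *)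

theory Defs
  imports "HOL-Analysis.Analysis" "HOL-Computational_Algebra.Polynomial"
begin

(* Local expansion as a power series in d real variables; a multi-index is a
   function 'd => nat.  The unordered summation of has_sum is absolute convergence
   when the values lie in a finite-dimensional space. *)
definition real_analytic_at ::
    "(real ^ 'd \<Rightarrow> 'b::real_normed_vector) \<Rightarrow> real ^ 'd \<Rightarrow> bool" where
  "real_analytic_at f x \<longleftrightarrow>
     (\<exists>r>0. \<exists>c :: ('d \<Rightarrow> nat) \<Rightarrow> 'b. \<forall>y\<in>ball x r.
        ((\<lambda>\<alpha>. (\<Prod>i\<in>UNIV. (y $ i - x $ i) ^ \<alpha> i) *\<^sub>R c \<alpha>) has_sum f y) UNIV)"

definition real_analytic :: "(real ^ 'd \<Rightarrow> 'b::real_normed_vector) \<Rightarrow> bool" where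
  "real_analytic f \<longleftrightarrow> (\<forall>x. real_analytic_at f x)"

definition hermitian :: "complex ^ 'n ^ 'n \<Rightarrow> bool" where
  "hermitian A \<longleftrightarrow> (\<forall>i j. A $ i $ j = cnj (A $ j $ i))"

definition is_eigenvalue :: "'a::field ^ 'n ^ 'n \<Rightarrow> 'a \<Rightarrow> bool" where
  "is_eigenvalue A \<mu> \<longleftrightarrow> (\<exists>v. v \<noteq> 0 \<and> A *v v = \<mu> *s v)"

(* Meant for complex Hermitian and real symmetric matrices: their eigenvalues are
   real, so the set of real eigenvalues below is finite, nonempty and is the whole
   spectrum. *)
definition lambda_min :: "'a::real_field ^ 'n ^ 'n \<Rightarrow> real" where
  "lambda_min A = Min {r. is_eigenvalue A (of_real r)}"

definition lambda_max :: "'a::real_field ^ 'n ^ 'n \<Rightarrow> real" where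
  "lambda_max A = Max {r. is_eigenvalue A (of_real r)}"

definition charpoly :: "'a::field ^ 'n ^ 'n \<Rightarrow> 'a poly" where
  "charpoly A = det (mat [:0, 1:] - (\<chi> i j. [:A $ i $ j:]))"

definition simple_eigenvalue :: "'a::field ^ 'n ^ 'n \<Rightarrow> 'a \<Rightarrow> bool" where
  "simple_eigenvalue A \<mu> \<longleftrightarrow> order \<mu> (charpoly A) = 1"

definition partial_derivative ::
    "'d \<Rightarrow> (real ^ 'd \<Rightarrow> 'b::real_normed_vector) \<Rightarrow> real ^ 'd \<Rightarrow> 'b" where
  "partial_derivative k f x = vector_derivative (\<lambda>t. f (x + t *\<^sub>R axis k 1)) (at 0)"

definition hessian :: "(real ^ 'd \<Rightarrow> real) \<Rightarrow> real ^ 'd \<Rightarrow> real ^ 'd ^ 'd" where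
  "hessian f x = (\<chi> k l. partial_derivative k (partial_derivative l f) x)"

(* The nd x nd matrix is indexed by pairs (k, i): block index k, then position i
   inside the block. *)
definition block_hessian ::
    "(real ^ 'd \<Rightarrow> complex ^ 'n ^ 'n) \<Rightarrow> real ^ 'd \<Rightarrow> complex ^ ('d \<times> 'n) ^ ('d \<times> 'n)" where
  "block_hessian A x = (\<chi> p q.
     partial_derivative (fst p) (partial_derivative (fst q) A) x $ snd p $ snd q)"

end

theory Submission
  imports Defs
begin

text \<open>
  Let \<open>v\<close> be an eigenvector of \<open>A \<omega>\<close> for the smallest eigenvalue. By the Rayleigh principle the
  function \<open>x \<mapsto> v\<^sup>* A(x) v - |v|\<^sup>2 \<lambda>\<^sub>m\<^sub>i\<^sub>n(A(x))\<close> is nonnegative and vanishes at \<open>\<omega>\<close>, so its Hessian at \<open>\<omega>\<close>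
  is positive semidefinite. Testing it with a top eigenvector \<open>h\<close> of the Hessian of
  \<open>\<lambda>\<^sub>m\<^sub>i\<^sub>n(A(x))\<close> bounds the top eigenvalue by the Rayleigh quotient of the block Hessian at
  \<open>h \<otimes> v\<close>. Twice differentiability of the smallest eigenvalue, needed for its Hessian to be
  symmetric and meaningful, follows by implicit differentiation of the characteristic equation:
  the eigenvalue depends Lipschitz continuously on the matrix, and at a simple root the derivative
  of the characteristic polynomial does not vanish.
\<close>

subsection \<open>Functions with continuous partial derivatives\<close>

text \<open>Freezing \<open>v\<close> at its value at \<omega> makes the argument elementary: no
  differentiable choice of eigenvectors enters, and the price, an inequality in place of a formula
  for the Hessian of the eigenvalue, is just what is claimed. Two obstacles remain.
  \<open>lambda_max\<close> is a \<open>Max\<close> over real eigenvalues, so both matrices must be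
  shown self-adjoint before it says anything; in both cases this rests on the symmetry of mixed
  second partials. And the eigenvalue is at first known only to be continuous, while implicit
  differentiation wants to differentiate it; the product rule
  \<open>has_derivative_mult_at_zero\<close>, which asks mere continuity of one factor, breaks this
  circle. Regularity is graded by an order \<open>k\<close> because the formula for the derivative
  of a root gains one order at a time; total differentiability is built into every order so that
  chain and product rules apply at once. Spectral arguments run over real Euclidean spaces: on
  \<open>complex ^ 'n\<close> the product \<open>\<bullet>\<close> is the real part of the Hermitian
  form.\<close>

primrec cont_diff_on :: "nat \<Rightarrow> (real ^ 'd \<Rightarrow> 'b::real_normed_vector) \<Rightarrow> (real ^ 'd) set \<Rightarrow> bool" where
  "cont_diff_on 0 f U \<longleftrightarrow> continuous_on U f"
| "cont_diff_on (Suc k) f U \<longleftrightarrow>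
     (\<forall>x\<in>U. f differentiable (at x)) \<and> (\<forall>i. cont_diff_on k (partial_derivative i f) U)"

lemma has_vector_derivative_line:
  fixes f :: "'a::real_normed_vector \<Rightarrow> 'b::real_normed_vector"
  assumes "(f has_derivative f') (at (c + s *\<^sub>R h))"
  shows "((\<lambda>t. f (c + t *\<^sub>R h)) has_vector_derivative f' h) (at s)"
proof -
  have "((\<lambda>t. c + t *\<^sub>R h) has_vector_derivative h) (at s)"
    by (auto intro!: derivative_eq_intros)
  from vector_derivative_diff_chain_within[OF this, of f f'] assms show ?thesis
    by (simp add: o_def has_derivative_at_withinI)
qed

lemma partial_derivative_eq:
  assumes "(f has_derivative f') (at x)"
  shows "partial_derivative i f x = f' (axis i 1)"
  unfolding partial_derivative_def
  using has_vector_derivative_line[of f f' x 0] assms by (simp add: vector_derivative_at)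

lemma partial_derivative_cong:
  assumes "open U" "x \<in> U" "\<And>y. y \<in> U \<Longrightarrow> f y = g y"
  shows "partial_derivative i f x = partial_derivative i g x"
  unfolding partial_derivative_def
proof (rule vector_derivative_cong_eq)
  have "((\<lambda>t. x + t *\<^sub>R axis i 1) \<longlongrightarrow> x + 0 *\<^sub>R axis i (1::real)) (nhds 0)"
    by (intro tendsto_intros filterlim_ident)
  then have "\<forall>\<^sub>F t in nhds 0. x + t *\<^sub>R axis i 1 \<in> U"
    using assms(1,2) by (auto dest: topological_tendstoD)
  then show "\<forall>\<^sub>F t in nhds 0. t \<in> UNIV \<longrightarrow> f (x + t *\<^sub>R axis i 1) = g (x + t *\<^sub>R axis i 1)"
    by eventually_elim (use assms(3) in auto)
qed auto

lemma has_derivative_partial: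
  fixes f :: "real ^ 'd \<Rightarrow> 'b::real_normed_vector"
  assumes "f differentiable (at x)"
  shows "(f has_derivative (\<lambda>h. \<Sum>i\<in>UNIV. h $ i *\<^sub>R partial_derivative i f x)) (at x)"
proof -
  obtain f' where f': "(f has_derivative f') (at x)"
    using assms by (auto simp: differentiable_def)
  interpret linear f' using f' by (rule has_derivative_linear)
  have "f' h = (\<Sum>i\<in>UNIV. h $ i *\<^sub>R partial_derivative i f x)" for h
  proof -
    have "f' h = f' (\<Sum>i\<in>UNIV. h $ i *\<^sub>R axis i 1)"
      using basis_expansion[of h] by (simp add: scalar_mult_eq_scaleR)
    then show ?thesis by (simp add: sum scaleR partial_derivative_eq[OF f'])
  qed
  then have "f' = (\<lambda>h. \<Sum>i\<in>UNIV. h $ i *\<^sub>R partial_derivative i f x)" by auto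
  with f' show ?thesis by simp
qed

lemma cont_diff_on_cong:
  assumes "open U" "\<And>y. y \<in> U \<Longrightarrow> f y = g y" "cont_diff_on k f U"
  shows "cont_diff_on k g U"
  using assms(2,3)
proof (induction k arbitrary: f g)
  case 0
  then show ?case by (simp cong: continuous_on_cong)
next
  case (Suc k)
  show ?case unfolding cont_diff_on.simps
  proof (intro conjI ballI allI)
    fix x assume "x \<in> U"
    then have "f differentiable (at x)" using Suc.prems by simp
    then show "g differentiable (at x)"
      using has_derivative_transform_within_open[OF _ \<open>open U\<close> \<open>x \<in> U\<close>] Suc.prems(1)
      unfolding differentiable_def by blast
  next
    fix i show "cont_diff_on k (partial_derivative i g) U"
    proof (rule Suc.IH)
      show "partial_derivative i f y = partial_derivative i g y" if "y \<in> U" for y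
        using partial_derivative_cong[OF \<open>open U\<close> that Suc.prems(1)] .
      show "cont_diff_on k (partial_derivative i f) U" using Suc.prems by simp
    qed
  qed
qed

text \<open>The entry point for the closure properties below: a calculus rule supplies some total
  derivative, and its values on the axes are the partials whose order is then checked by
  induction.\<close>

lemma cont_diff_on_SucI:
  assumes "open U" "\<And>x. x \<in> U \<Longrightarrow> (f has_derivative f' x) (at x)"
    and "\<And>i. cont_diff_on k (\<lambda>x. f' x (axis i 1)) U"
  shows "cont_diff_on (Suc k) f U"
  unfolding cont_diff_on.simps
proof (intro conjI ballI allI)
  show "f differentiable (at x)" if "x \<in> U" for x
    using assms(2)[OF that] by (auto simp: differentiable_def)
  show "cont_diff_on k (partial_derivative i f) U" for i
    by (rule cont_diff_on_cong[OF \<open>open U\<close> _ assms(3)[of i]])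
      (simp add: partial_derivative_eq[OF assms(2)])
qed

lemma cont_diff_on_imp_continuous_on:
  "cont_diff_on k f U \<Longrightarrow> continuous_on U f"
  by (cases k) (auto intro!: differentiable_imp_continuous_on
      simp: differentiable_on_def differentiable_at_withinI)

lemma cont_diff_on_Suc:
  "cont_diff_on (Suc k) f U \<Longrightarrow> cont_diff_on k f U"
proof (induction k arbitrary: f)
  case 0
  then show ?case using cont_diff_on_imp_continuous_on by fastforce
next
  case (Suc k)
  then show ?case by simp
qed

lemma cont_diff_on_subset:
  "cont_diff_on k f U \<Longrightarrow> V \<subseteq> U \<Longrightarrow> cont_diff_on k f V"
  by (induction k arbitrary: f) (auto intro: continuous_on_subset)

lemma cont_diff_on_const: "open U \<Longrightarrow> cont_diff_on k (\<lambda>x. c) U"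
proof (induction k arbitrary: c)
  case (Suc k)
  then show ?case by (intro cont_diff_on_SucI[where f' = "\<lambda>x h. 0"]) auto
qed simp

text \<open>Recovers a single partial when the derivative from \<open>has_derivative_partial\<close>
  is evaluated at a unit vector.\<close>

lemma sum_axis_scaleR:
  fixes g :: "'d::finite \<Rightarrow> 'b::real_vector"
  shows "(\<Sum>j\<in>UNIV. axis i (1::real) $ j *\<^sub>R g j) = g i"
  by (subst sum.remove[of _ i]) (auto simp: axis_def intro!: sum.neutral)

lemma cont_diff_on_bounded_linear:
  assumes "bounded_linear T" "open U" "cont_diff_on k f U"
  shows "cont_diff_on k (\<lambda>x. T (f x)) U"
  using assms(3)
proof (induction k arbitrary: f)
  case 0
  then show ?case using bounded_linear.continuous_on[OF assms(1)] by simp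
next
  case (Suc k)
  show ?case
  proof (rule cont_diff_on_SucI[OF \<open>open U\<close>])
    fix x assume "x \<in> U"
    then have "f differentiable (at x)" using Suc.prems by simp
    from bounded_linear.has_derivative[OF assms(1) has_derivative_partial[OF this]]
    show "((\<lambda>x. T (f x)) has_derivative
        (\<lambda>h. T (\<Sum>i\<in>UNIV. h $ i *\<^sub>R partial_derivative i f x))) (at x)" .
  next
    fix i
    show "cont_diff_on k (\<lambda>x. T (\<Sum>j\<in>UNIV. axis i 1 $ j *\<^sub>R partial_derivative j f x)) U"
      unfolding sum_axis_scaleR using Suc by simp
  qed
qed

lemma partial_derivative_bounded_linear:
  assumes "bounded_linear T" "f differentiable (at x)"
  shows "partial_derivative i (\<lambda>x. T (f x)) x = T (partial_derivative i f x)"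
proof -
  obtain f' where f': "(f has_derivative f') (at x)"
    using assms(2) by (auto simp: differentiable_def)
  show ?thesis
    using partial_derivative_eq[OF bounded_linear.has_derivative[OF assms(1) f']]
      partial_derivative_eq[OF f'] by metis
qed

text \<open>Serves matrix entries, real and imaginary parts, conjugation, scaling and the quadratic
  form of a fixed vector, so that second partials of a matrix function can be read off scalar
  functions.\<close>

lemma partial_derivative2_bounded_linear:
  assumes "bounded_linear T" "open U" "cont_diff_on 2 f U" "x \<in> U"
  shows "partial_derivative k (partial_derivative l (\<lambda>x. T (f x))) x =
    T (partial_derivative k (partial_derivative l f) x)"
proof -
  have "partial_derivative k (partial_derivative l (\<lambda>x. T (f x))) x =
      partial_derivative k (\<lambda>x. T (partial_derivative l f x)) x"
    by (rule partial_derivative_cong[OF assms(2,4)])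
      (use assms in \<open>simp add: partial_derivative_bounded_linear numeral_2_eq_2\<close>)
  also have "\<dots> = T (partial_derivative k (partial_derivative l f) x)"
    by (rule partial_derivative_bounded_linear) (use assms in \<open>simp_all add: numeral_2_eq_2\<close>)
  finally show ?thesis .
qed

lemma cont_diff_on_add:
  assumes "open U" "cont_diff_on k f U" "cont_diff_on k g U"
  shows "cont_diff_on k (\<lambda>x. f x + g x) U"
  using assms(2,3)
proof (induction k arbitrary: f g)
  case 0
  then show ?case by (auto intro: continuous_intros)
next
  case (Suc k)
  show ?case
  proof (rule cont_diff_on_SucI[OF \<open>open U\<close>])
    fix x assume "x \<in> U"
    then have "f differentiable (at x)" "g differentiable (at x)" using Suc.prems by auto
    from has_derivative_add[OF this[THEN has_derivative_partial]]
    show "((\<lambda>x. f x + g x) has_derivative (\<lambda>h. (\<Sum>i\<in>UNIV. h $ i *\<^sub>R partial_derivative i f x) +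
        (\<Sum>i\<in>UNIV. h $ i *\<^sub>R partial_derivative i g x))) (at x)" .
  qed (use Suc in \<open>simp add: sum_axis_scaleR\<close>)
qed

lemma cont_diff_on_mult:
  fixes f g :: "real ^ 'd \<Rightarrow> 'b::real_normed_field"
  assumes "open U" "cont_diff_on k f U" "cont_diff_on k g U"
  shows "cont_diff_on k (\<lambda>x. f x * g x) U"
  using assms(2,3)
proof (induction k arbitrary: f g)
  case 0
  then show ?case by (auto intro: continuous_intros)
next
  case (Suc k)
  show ?case
  proof (rule cont_diff_on_SucI[OF \<open>open U\<close>])
    fix x assume "x \<in> U"
    then have "f differentiable (at x)" "g differentiable (at x)" using Suc.prems by auto
    from has_derivative_mult[OF this[THEN has_derivative_partial]]
    show "((\<lambda>x. f x * g x) has_derivative (\<lambda>h. f x * (\<Sum>i\<in>UNIV. h $ i *\<^sub>R partial_derivative i g x) +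
        (\<Sum>i\<in>UNIV. h $ i *\<^sub>R partial_derivative i f x) * g x)) (at x)" .
  next
    fix i
    show "cont_diff_on k (\<lambda>x. f x * (\<Sum>j\<in>UNIV. axis i 1 $ j *\<^sub>R partial_derivative j g x) +
        (\<Sum>j\<in>UNIV. axis i 1 $ j *\<^sub>R partial_derivative j f x) * g x) U"
      \<comment> \<open>Each product pairs a partial of order \<open>k\<close> with an
        undifferentiated factor, whose order \<open>Suc k\<close> is lowered to \<open>k\<close> for
        the induction hypothesis.\<close>
      using Suc.prems Suc.prems[THEN cont_diff_on_Suc]
      by (simp only: sum_axis_scaleR) (intro cont_diff_on_add Suc.IH \<open>open U\<close>; simp)
  qed
qed

lemma cont_diff_on_sum:
  assumes "open U" "\<And>i. i \<in> I \<Longrightarrow> cont_diff_on k (f i) U"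
  shows "cont_diff_on k (\<lambda>x. \<Sum>i\<in>I. f i x) U"
  using assms(2)
  by (induction I rule: infinite_finite_induct)
    (auto simp: cont_diff_on_const[OF assms(1)] intro!: cont_diff_on_add[OF assms(1)])

lemma cont_diff_on_power:
  fixes f :: "real ^ 'd \<Rightarrow> 'b::real_normed_field"
  assumes "open U" "cont_diff_on k f U"
  shows "cont_diff_on k (\<lambda>x. f x ^ n) U"
  by (induction n)
    (use assms in \<open>auto simp: cont_diff_on_const[OF assms(1)] intro!: cont_diff_on_mult[OF assms(1)]\<close>)

text \<open>The derivative of 1/f is made of 1/f itself and partials of f, so order \<open>k\<close>
  of 1/f yields order \<open>Suc k\<close> with the same f.\<close>

lemma cont_diff_on_inverse:
  fixes f :: "real ^ 'd \<Rightarrow> 'b::real_normed_field"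
  assumes "open U" "cont_diff_on k f U" "\<And>x. x \<in> U \<Longrightarrow> f x \<noteq> 0"
  shows "cont_diff_on k (\<lambda>x. inverse (f x)) U"
  using assms(2)
proof (induction k)
  case 0
  then show ?case using assms(3) by (auto intro: continuous_intros)
next
  case (Suc k)
  show ?case
  proof (rule cont_diff_on_SucI[OF \<open>open U\<close>])
    fix x assume "x \<in> U"
    then have "f differentiable (at x)" using Suc.prems by auto
    from Deriv.has_derivative_inverse[OF assms(3)[OF \<open>x \<in> U\<close>] has_derivative_partial[OF this]]
    show "((\<lambda>x. inverse (f x)) has_derivative
        (\<lambda>h. - (inverse (f x) * (\<Sum>i\<in>UNIV. h $ i *\<^sub>R partial_derivative i f x) * inverse (f x)))) (at x)" .
  next
    fix i
    show "cont_diff_on k (\<lambda>x. - (inverse (f x) * (\<Sum>j\<in>UNIV. axis i 1 $ j *\<^sub>R partial_derivative j f x) * inverse (f x))) U"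
      using Suc.prems cont_diff_on_Suc[OF Suc.prems]
      by (simp only: sum_axis_scaleR)
        (intro cont_diff_on_bounded_linear[where T = uminus]
          cont_diff_on_mult Suc.IH \<open>open U\<close> bounded_linear_minus bounded_linear_ident; simp)
  qed
qed

section \<open>Symmetry of mixed partials and the second-order condition at a minimum\<close>

lemma second_difference_mvt:
  fixes f :: "real ^ 'd \<Rightarrow> real"
  assumes cd: "cont_diff_on 2 f U" and t: "t > 0" and sub: "cball x (2 * t) \<subseteq> U"
  shows "\<exists>p\<in>cball x (2 * t).
    f (x + t *\<^sub>R axis k 1 + t *\<^sub>R axis l 1) - f (x + t *\<^sub>R axis k 1) - f (x + t *\<^sub>R axis l 1) + f x
    = t\<^sup>2 * partial_derivative l (partial_derivative k f) p"
proof -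
  have dist: "x + s *\<^sub>R axis k 1 + u *\<^sub>R axis l 1 \<in> cball x (2 * t)"
    if "0 \<le> s" "s \<le> t" "0 \<le> u" "u \<le> t" for s u
    using that norm_triangle_ineq[of "s *\<^sub>R axis k (1::real)" "u *\<^sub>R axis l 1"]
    by (simp add: mem_cball dist_norm norm_axis_1 norm_minus_commute add_ac)
  have df: "f differentiable (at y)" "partial_derivative k f differentiable (at y)"
    if "y \<in> cball x (2 * t)" for y
    using cd sub that by (auto simp: numeral_2_eq_2)
  have line: "((\<lambda>s. g (c + s *\<^sub>R axis i 1)) has_real_derivative partial_derivative i g (c + s *\<^sub>R axis i 1)) (at s)"
    if "g differentiable (at (c + s *\<^sub>R axis i 1))" for g :: "real ^ 'd \<Rightarrow> real" and c s i
    using has_vector_derivative_line[OF has_derivative_partial[OF that]]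
    by (simp only: sum_axis_scaleR has_real_derivative_iff_has_vector_derivative)
  \<comment> \<open>The increment of \<open>\<phi>\<close> over [0, t] is the second difference. One
    mean value step along k and one along l turn it into a mixed partial.\<close>
  define \<phi> where "\<phi> s = f (x + t *\<^sub>R axis l 1 + s *\<^sub>R axis k 1) - f (x + s *\<^sub>R axis k 1)" for s
  have "\<exists>z. 0 < z \<and> z < t \<and> \<phi> t - \<phi> 0 = (t - 0) *
      (partial_derivative k f (x + t *\<^sub>R axis l 1 + z *\<^sub>R axis k 1) - partial_derivative k f (x + z *\<^sub>R axis k 1))"
  proof (rule MVT2[OF t])
    fix s assume s: "0 \<le> s" "s \<le> t"
    show "(\<phi> has_real_derivative partial_derivative k f (x + t *\<^sub>R axis l 1 + s *\<^sub>R axis k 1)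
        - partial_derivative k f (x + s *\<^sub>R axis k 1)) (at s)"
      unfolding \<phi>_def
      by (intro DERIV_diff line df)
        (use dist[OF s, of t] dist[OF s, of 0] t in \<open>simp_all add: add_ac\<close>)
  qed
  then obtain \<xi> where \<xi>: "0 < \<xi>" "\<xi> < t" "\<phi> t - \<phi> 0 = t *
      (partial_derivative k f (x + t *\<^sub>R axis l 1 + \<xi> *\<^sub>R axis k 1) - partial_derivative k f (x + \<xi> *\<^sub>R axis k 1))"
    by auto
  have "\<exists>z. 0 < z \<and> z < t \<and> partial_derivative k f (x + \<xi> *\<^sub>R axis k 1 + t *\<^sub>R axis l 1)
      - partial_derivative k f (x + \<xi> *\<^sub>R axis k 1 + 0 *\<^sub>R axis l 1) = (t - 0) *
      partial_derivative l (partial_derivative k f) (x + \<xi> *\<^sub>R axis k 1 + z *\<^sub>R axis l 1)"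
    by (rule MVT2[OF t]) (intro line df dist; use \<xi> in simp)
  then obtain \<eta> where \<eta>: "0 < \<eta>" "\<eta> < t" "partial_derivative k f (x + \<xi> *\<^sub>R axis k 1 + t *\<^sub>R axis l 1)
      - partial_derivative k f (x + \<xi> *\<^sub>R axis k 1) = t *
      partial_derivative l (partial_derivative k f) (x + \<xi> *\<^sub>R axis k 1 + \<eta> *\<^sub>R axis l 1)"
    by auto
  show ?thesis
  proof (rule bexI)
    show "x + \<xi> *\<^sub>R axis k 1 + \<eta> *\<^sub>R axis l 1 \<in> cball x (2 * t)"
      using dist \<xi> \<eta> by simp
    show "f (x + t *\<^sub>R axis k 1 + t *\<^sub>R axis l 1) - f (x + t *\<^sub>R axis k 1) - f (x + t *\<^sub>R axis l 1) + f x
      = t\<^sup>2 * partial_derivative l (partial_derivative k f) (x + \<xi> *\<^sub>R axis k 1 + \<eta> *\<^sub>R axis l 1)"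
      using \<xi>(3) \<eta>(3) by (simp add: \<phi>_def power2_eq_square add_ac)
  qed
qed

text \<open>The second difference is symmetric in k and l. Hence both mixed partials take, at points
  close to x, the same value, namely that difference divided by \<open>t\<^sup>2\<close>; continuity
  at x does the rest.\<close>

lemma partial_derivative_commute_real:
  fixes f :: "real ^ 'd \<Rightarrow> real"
  assumes cd: "cont_diff_on 2 f U" and U: "open U" "x \<in> U"
  shows "partial_derivative k (partial_derivative l f) x = partial_derivative l (partial_derivative k f) x"
proof -
  let ?P = "partial_derivative k (partial_derivative l f)"
  let ?Q = "partial_derivative l (partial_derivative k f)"
  have cont: "isCont ?P x" "isCont ?Q x"
    using cd U by (auto simp: numeral_2_eq_2 continuous_on_eq_continuous_at)
  have "\<bar>?P x - ?Q x\<bar> \<le> e" if "e > 0" for e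
  proof -
    obtain d1 where d1: "d1 > 0" "\<And>y. dist y x < d1 \<Longrightarrow> dist (?P y) (?P x) < e/2"
      using cont(1) \<open>e > 0\<close> unfolding continuous_at_eps_delta by (metis half_gt_zero)
    obtain d2 where d2: "d2 > 0" "\<And>y. dist y x < d2 \<Longrightarrow> dist (?Q y) (?Q x) < e/2"
      using cont(2) \<open>e > 0\<close> unfolding continuous_at_eps_delta by (metis half_gt_zero)
    obtain d3 where d3: "d3 > 0" "cball x d3 \<subseteq> U"
      using U open_contains_cball by blast
    define t where "t = min d3 (min d1 d2) / 4"
    have t: "t > 0" "2 * t < d1" "2 * t < d2" "2 * t \<le> d3"
      using d1 d2 d3 by (auto simp: t_def)
    have sub: "cball x (2 * t) \<subseteq> U" using t d3 by (meson dual_order.trans subset_cball)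
    obtain p where p: "p \<in> cball x (2 * t)"
      "f (x + t *\<^sub>R axis k 1 + t *\<^sub>R axis l 1) - f (x + t *\<^sub>R axis k 1) - f (x + t *\<^sub>R axis l 1) + f x
        = t\<^sup>2 * ?Q p"
      using second_difference_mvt[OF cd t(1) sub] by blast
    obtain q where q: "q \<in> cball x (2 * t)"
      "f (x + t *\<^sub>R axis l 1 + t *\<^sub>R axis k 1) - f (x + t *\<^sub>R axis l 1) - f (x + t *\<^sub>R axis k 1) + f x
        = t\<^sup>2 * ?P q"
      using second_difference_mvt[OF cd t(1) sub] by blast
    have "x + t *\<^sub>R axis l 1 + t *\<^sub>R axis k 1 = x + t *\<^sub>R axis k 1 + t *\<^sub>R axis l 1"
      by (simp add: add_ac)
    then have "t\<^sup>2 * ?Q p = t\<^sup>2 * ?P q" using p(2) q(2) by (simp only:)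
    then have eq: "?Q p = ?P q" using t by simp
    have "dist (?P q) (?P x) < e/2" "dist (?Q p) (?Q x) < e/2"
      using d1(2)[of q] d2(2)[of p] p(1) q(1) t by (auto simp: dist_commute)
    with eq show ?thesis by (simp add: dist_real_def abs_if split: if_splits)
  qed
  then have "\<bar>?P x - ?Q x\<bar> \<le> 0" by (rule field_le_epsilon) simp
  then show ?thesis by simp
qed

text \<open>At a minimum the first derivative vanishes. A negative second derivative would make it
  negative just to the right of 0, and the mean value theorem would then give a value below the
  minimum.\<close>

lemma second_derivative_nonneg_at_min:
  fixes \<phi> \<phi>' :: "real \<Rightarrow> real"
  assumes "d > 0" and min: "\<And>t. \<bar>t\<bar> < d \<Longrightarrow> \<phi> 0 \<le> \<phi> t"
    and d1: "\<And>t. \<bar>t\<bar> < d \<Longrightarrow> (\<phi> has_real_derivative \<phi>' t) (at t)"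
    and d2: "(\<phi>' has_real_derivative c) (at 0)"
  shows "c \<ge> 0"
proof (rule ccontr)
  assume "\<not> c \<ge> 0"
  have "\<phi>' 0 = 0"
    by (rule DERIV_local_min[OF d1 \<open>d > 0\<close>]) (use \<open>d > 0\<close> min in auto)
  with DERIV_neg_dec_right[OF d2] \<open>\<not> c \<ge> 0\<close>
  obtain e where e: "e > 0" "\<And>h. 0 < h \<Longrightarrow> h < e \<Longrightarrow> \<phi>' h < 0" by auto
  define t where "t = min d e / 2"
  have t: "0 < t" "t < d" "t < e" using \<open>d > 0\<close> e by (auto simp: t_def)
  have "\<exists>z. 0 < z \<and> z < t \<and> \<phi> t - \<phi> 0 = (t - 0) * \<phi>' z"
    by (rule MVT2) (use t d1 in auto)
  then obtain z where "0 < z" "z < t" "\<phi> t - \<phi> 0 = t * \<phi>' z" by auto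
  then have "\<phi> t < \<phi> 0" using e(2)[of z] t mult_pos_neg[of t "\<phi>' z"] by auto
  with min[of t] t show False by auto
qed

lemma hessian_nonneg_at_min:
  fixes f :: "real ^ 'd \<Rightarrow> real"
  assumes cd: "cont_diff_on 2 f U" and U: "open U" "x \<in> U"
    and min: "\<And>y. y \<in> U \<Longrightarrow> f x \<le> f y"
  shows "0 \<le> (\<Sum>k\<in>UNIV. \<Sum>l\<in>UNIV. h $ k * h $ l * hessian f x $ k $ l)"
proof -
  have "\<exists>d>0. \<forall>t. \<bar>t\<bar> < d \<longrightarrow> x + t *\<^sub>R h \<in> U"
  proof -
    have "((\<lambda>t. x + t *\<^sub>R h) \<longlongrightarrow> x + 0 *\<^sub>R h) (nhds 0)"
      by (intro tendsto_intros filterlim_ident)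
    then have "\<forall>\<^sub>F t in nhds 0. x + t *\<^sub>R h \<in> U"
      using U by (auto dest: topological_tendstoD)
    then show ?thesis by (simp add: eventually_nhds_metric)
  qed
  then obtain d where d: "d > 0" "\<And>t. \<bar>t\<bar> < d \<Longrightarrow> x + t *\<^sub>R h \<in> U" by blast
  have line: "((\<lambda>t. g (x + t *\<^sub>R h)) has_real_derivative
      (\<Sum>i\<in>UNIV. h $ i * partial_derivative i g (x + s *\<^sub>R h))) (at s)"
    if "g differentiable (at (x + s *\<^sub>R h))" for g :: "real ^ 'd \<Rightarrow> real" and s
    using has_vector_derivative_line[OF has_derivative_partial[OF that]]
    by (simp add: has_real_derivative_iff_has_vector_derivative)
  have "((\<lambda>t. \<Sum>l\<in>UNIV. h $ l * partial_derivative l f (x + t *\<^sub>R h)) has_real_derivative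
      (\<Sum>l\<in>UNIV. h $ l * (\<Sum>k\<in>UNIV. h $ k * partial_derivative k (partial_derivative l f) (x + 0 *\<^sub>R h)))) (at 0)"
    by (intro DERIV_sum DERIV_cmult line) (use cd U in \<open>simp add: numeral_2_eq_2\<close>)
  then have "0 \<le> (\<Sum>l\<in>UNIV. h $ l * (\<Sum>k\<in>UNIV. h $ k * partial_derivative k (partial_derivative l f) (x + 0 *\<^sub>R h)))"
    by (rule second_derivative_nonneg_at_min[OF d(1), rotated 2, where \<phi> = "\<lambda>t. f (x + t *\<^sub>R h)"])
      (use d min U cd in \<open>auto intro!: line simp: numeral_2_eq_2\<close>)
  \<comment> \<open>The outer sum runs over the inner differentiation l, whereas the row index of
    the Hessian is the outer differentiation k; hence the swap.\<close>
  also have "\<dots> = (\<Sum>k\<in>UNIV. \<Sum>l\<in>UNIV. h $ k * h $ l * hessian f x $ k $ l)"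
    unfolding sum_distrib_left by (subst sum.swap) (simp add: hessian_def mult_ac)
  finally show ?thesis .
qed

subsection \<open>Power series in several variables\<close>

text \<open>For real families unconditional and absolute summability agree; the finitely many
  coordinates then dominate the norm.\<close>

lemma abs_summable_on_euclidean:
  fixes f :: "'a \<Rightarrow> 'b::euclidean_space"
  assumes "f summable_on A"
  shows "(\<lambda>x. norm (f x)) summable_on A"
proof (rule Infinite_Sum.abs_summable_on_comparison_test')
  have "(\<lambda>x. \<bar>f x \<bullet> b\<bar>) summable_on A" for b
    using summable_on_iff_abs_summable_on_real[THEN iffD1,
        OF summable_on_bounded_linear[OF bounded_linear_inner_left assms, of b]] by simp
  then have "(\<lambda>x. \<Sum>b\<in>B. \<bar>f x \<bullet> b\<bar>) summable_on A" for B
    by (induction B rule: infinite_finite_induct) (auto intro: summable_on_add)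
  then show "(\<lambda>x. \<Sum>b\<in>Basis. \<bar>f x \<bullet> b\<bar>) summable_on A" .
  show "norm (f x) \<le> (\<Sum>b\<in>Basis. \<bar>f x \<bullet> b\<bar>)" for x
    by (rule norm_le_l1)
qed

text \<open>Monomials are bounded coordinate by coordinate, so cubes fit power series better than
  balls: convergence at one point on the diagonal controls a whole smaller cube.\<close>

definition open_cube :: "real ^ 'd \<Rightarrow> real \<Rightarrow> (real ^ 'd) set" where
  "open_cube x r = {y. \<forall>i. \<bar>y $ i - x $ i\<bar> < r}"

lemma open_cube_eq_box: "open_cube x r = box (\<chi> i. x $ i - r) (\<chi> i. x $ i + r)"
  by (auto simp: open_cube_def mem_box_cart abs_less_iff) (smt (verit))+

lemma open_open_cube: "open (open_cube x r)" and convex_open_cube: "convex (open_cube x r)"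
  by (simp_all add: open_cube_eq_box open_box convex_box)

lemma open_cube_mono: "r \<le> s \<Longrightarrow> open_cube x r \<subseteq> open_cube x s"
  by (auto simp: open_cube_def intro: less_le_trans)

text \<open>The i-th partial of the monomial with exponent \<alpha>. When
  \<open>\<alpha> i = 0\<close> the truncated exponent \<open>\<alpha> i - 1\<close> is harmless,
  since the factor \<open>real (\<alpha> i)\<close> vanishes.\<close>

definition monomial_deriv :: "'d \<Rightarrow> ('d::finite \<Rightarrow> nat) \<Rightarrow> real ^ 'd \<Rightarrow> real" where
  "monomial_deriv i \<alpha> z = real (\<alpha> i) * z $ i ^ (\<alpha> i - 1) * (\<Prod>j\<in>UNIV - {i}. z $ j ^ \<alpha> j)"

lemma has_derivative_monomial:
  "((\<lambda>y. \<Prod>i\<in>UNIV. (y $ i - x $ i) ^ \<alpha> i) has_derivative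
     (\<lambda>h. \<Sum>i\<in>UNIV. h $ i * monomial_deriv i \<alpha> (y - x))) (at y)"
proof -
  have "((\<lambda>y. (y $ i - x $ i) ^ \<alpha> i) has_derivative
      (\<lambda>h. real (\<alpha> i) * h $ i * (y $ i - x $ i) ^ (\<alpha> i - 1))) (at y)" for i
    by (auto intro!: derivative_eq_intros bounded_linear.has_derivative[OF bounded_linear_vec_nth])
  from has_derivative_prod[OF this, where I = UNIV] show ?thesis
    by (rule has_derivative_eq_rhs) (auto simp: monomial_deriv_def mult_ac intro!: sum.cong)
qed

text \<open>Differentiation costs a factor of at most m, the total degree. Since m is at most 2 ^ m,
  halving the cube pays for it, and the remaining \<open>R ^ m\<close> is summable against the
  coefficients.\<close>

lemma monomial_deriv_bound:
  fixes z :: "real ^ 'd"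
  assumes "R > 0" and z: "\<And>j. \<bar>z $ j\<bar> \<le> R / 2"
  shows "\<bar>monomial_deriv i \<alpha> z\<bar> \<le> 2 / R * R ^ sum \<alpha> UNIV"
proof (cases "\<alpha> i = 0")
  case True
  then show ?thesis using assms(1) by (simp add: monomial_deriv_def)
next
  case False
  define m where "m = sum \<alpha> UNIV"
  have m: "m = \<alpha> i + sum \<alpha> (UNIV - {i})" unfolding m_def by (simp add: sum.remove)
  have "\<bar>monomial_deriv i \<alpha> z\<bar> =
      real (\<alpha> i) * (\<bar>z $ i\<bar> ^ (\<alpha> i - 1) * (\<Prod>j\<in>UNIV - {i}. \<bar>z $ j\<bar> ^ \<alpha> j))"
    by (simp add: monomial_deriv_def abs_mult abs_prod power_abs)
  also have "\<dots> \<le> real (\<alpha> i) * ((R / 2) ^ (\<alpha> i - 1) * (\<Prod>j\<in>UNIV - {i}. (R / 2) ^ \<alpha> j))"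
    using assms by (intro mult_left_mono mult_mono power_mono prod_mono) (auto intro!: prod_nonneg power_mono)
  also have "\<dots> = real (\<alpha> i) * (R / 2) ^ (m - 1)"
    using False by (simp add: m flip: power_sum power_add)
  also have "\<dots> \<le> 2 ^ m * (R / 2) ^ (m - 1)"
  proof (rule mult_right_mono)
    have "\<alpha> i \<le> m" using m by simp
    then have "real (\<alpha> i) \<le> real m" by simp
    also have "\<dots> \<le> 2 ^ m" by (simp add: of_nat_less_two_power less_imp_le)
    finally show "real (\<alpha> i) \<le> 2 ^ m" .
  qed (use assms in simp)
  also have "\<dots> = 2 / R * R ^ m"
  proof -
    have "m > 0" using False m by linarith
    then obtain n where "m = Suc n" using gr0_implies_Suc by blast
    then show ?thesis using \<open>R > 0\<close> by (simp add: field_simps)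
  qed
  finally show ?thesis by (simp add: m_def)
qed

text \<open>Termwise differentiation by the Weierstrass M-test. The partials are again given as
  power series about the same centre, so that the lemma can be iterated.\<close>

lemma power_series_deriv:
  fixes f :: "real ^ 'd \<Rightarrow> 'b::euclidean_space" and c :: "('d \<Rightarrow> nat) \<Rightarrow> 'b"
  assumes "r > 0" and series: "\<And>y. y \<in> open_cube x r \<Longrightarrow>
      ((\<lambda>\<alpha>. (\<Prod>i\<in>UNIV. (y $ i - x $ i) ^ \<alpha> i) *\<^sub>R c \<alpha>) has_sum f y) UNIV"
  obtains G where
    "\<And>y. y \<in> open_cube x (r / 4) \<Longrightarrow> (f has_derivative (\<lambda>h. \<Sum>i\<in>UNIV. h $ i *\<^sub>R G i y)) (at y)"
    "\<And>i. \<exists>c'. \<forall>y\<in>open_cube x (r / 4).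
      ((\<lambda>\<alpha>. (\<Prod>i\<in>UNIV. (y $ i - x $ i) ^ \<alpha> i) *\<^sub>R c' \<alpha>) has_sum G i y) UNIV"
proof -
  \<comment> \<open>One halving puts the point with all offsets equal to \<open>R\<close> inside the
    cube of convergence; the halving in \<open>monomial_deriv_bound\<close> then leads to
    \<open>r / 4\<close>.\<close>
  define R where "R = r / 2"
  have "R > 0" using \<open>r > 0\<close> by (simp add: R_def)
  define S where "S = open_cube x (r / 4)"
  define M where "M \<alpha> = 2 / R * (R ^ sum \<alpha> UNIV * norm (c \<alpha>))" for \<alpha>
  \<comment> \<open>At this diagonal point every monomial equals \<open>R\<close> to its total
    degree, so summability there yields the majorant \<open>M\<close>.\<close>
  have "(\<lambda>\<alpha>. (\<Prod>i\<in>UNIV. ((\<chi> i. x $ i + R) $ i - x $ i) ^ \<alpha> i) *\<^sub>R c \<alpha>) summable_on UNIV"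
    by (rule has_sum_imp_summable[OF series]) (use \<open>r > 0\<close> in \<open>auto simp: open_cube_def R_def\<close>)
  from abs_summable_on_euclidean[OF this]
  have "(\<lambda>\<alpha>. R ^ sum \<alpha> UNIV * norm (c \<alpha>)) summable_on UNIV"
    using \<open>R > 0\<close> by (simp add: power_sum abs_prod)
  then have M: "M summable_on UNIV" unfolding M_def by (rule summable_on_cmult_right)
  define D where "D i \<alpha> y = monomial_deriv i \<alpha> (y - x) *\<^sub>R c \<alpha>" for i \<alpha> y
  have D_bound: "norm (D i \<alpha> y) \<le> M \<alpha>" if "y \<in> S" for i \<alpha> y
  proof -
    have "\<bar>monomial_deriv i \<alpha> (y - x)\<bar> \<le> 2 / R * R ^ sum \<alpha> UNIV"
      by (rule monomial_deriv_bound[OF \<open>R > 0\<close>])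
        (use that in \<open>auto simp: S_def open_cube_def R_def less_imp_le\<close>)
    from mult_right_mono[OF this norm_ge_zero[of "c \<alpha>"]] show ?thesis
      unfolding D_def M_def by (simp only: norm_scaleR mult.assoc)
  qed
  define G where "G i y = (\<Sum>\<^sub>\<infinity>\<alpha>. D i \<alpha> y)" for i y
  have D_sum: "((\<lambda>\<alpha>. D i \<alpha> y) has_sum G i y) UNIV" if "y \<in> S" for i y
    unfolding G_def
    by (rule has_sum_infsum[OF abs_summable_summable[OF
          Infinite_Sum.abs_summable_on_comparison_test'[OF M D_bound[OF that]]]])
  \<comment> \<open>Uniform convergence and \<open>has_derivative_series\<close> concern sequences,
    so the multi-indices are enumerated; an unordered sum keeps its value under any
    enumeration.\<close>
  have "infinite (UNIV :: ('d \<Rightarrow> nat) set)" by (simp add: finite_UNIV_fun)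
  then have bij: "bij_betw (from_nat_into UNIV) UNIV (UNIV :: ('d \<Rightarrow> nat) set)"
    by (intro bij_betw_from_nat_into) auto
  define e :: "nat \<Rightarrow> 'd \<Rightarrow> nat" where "e = from_nat_into UNIV"
  have e_sums: "(\<lambda>n. g (e n)) sums s" if "(g has_sum s) UNIV" for g :: "_ \<Rightarrow> 'z::real_normed_vector" and s
    using that has_sum_reindex_bij_betw[OF bij, where f = g and S = s] by (intro has_sum_imp_sums) (simp add: e_def)
  have lim: "uniform_limit S (\<lambda>n y. \<Sum>m<n. D i (e m) y) (G i) sequentially" for i
  proof -
    have "uniform_limit S (\<lambda>n y. \<Sum>m<n. D i (e m) y) (\<lambda>y. \<Sum>m. D i (e m) y) sequentially"
      by (rule Weierstrass_m_test[OF D_bound])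
        (use e_sums[OF has_sum_infsum[OF M]] in \<open>auto simp: sums_iff\<close>)
    then show ?thesis
      by (rule uniform_limit_cong'[THEN iffD1, rotated 2])
        (use e_sums[OF D_sum] in \<open>auto simp: sums_iff\<close>)
  qed
  have deriv: "(f has_derivative (\<lambda>h. \<Sum>i\<in>UNIV. h $ i *\<^sub>R G i y)) (at y)" if y: "y \<in> S" for y
  proof -
    have SS: "S \<subseteq> open_cube x r" unfolding S_def by (rule open_cube_mono) (use \<open>r > 0\<close> in simp)
    have "\<exists>g. \<forall>x'\<in>S. (\<lambda>n. (\<Prod>i\<in>UNIV. (x' $ i - x $ i) ^ e n i) *\<^sub>R c (e n)) sums g x' \<and>
        (g has_derivative (\<lambda>h. \<Sum>i\<in>UNIV. h $ i *\<^sub>R G i x')) (at x' within S)"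
    proof (rule has_derivative_series[where f' = "\<lambda>n y h. \<Sum>i\<in>UNIV. h $ i *\<^sub>R D i (e n) y"])
      show "convex S" unfolding S_def by (rule convex_open_cube)
      show "y \<in> S" by fact
      show "(\<lambda>n. (\<Prod>i\<in>UNIV. (y $ i - x $ i) ^ e n i) *\<^sub>R c (e n)) sums f y"
        by (rule e_sums[OF series]) (use y SS in auto)
      show "((\<lambda>y. (\<Prod>i\<in>UNIV. (y $ i - x $ i) ^ e n i) *\<^sub>R c (e n)) has_derivative
          (\<lambda>h. \<Sum>i\<in>UNIV. h $ i *\<^sub>R D i (e n) y)) (at y within S)" for n y
        using has_derivative_scaleR_left[OF has_derivative_monomial[of x "e n" y], of "c (e n)"]
        by (auto simp: D_def scaleR_sum_left intro: has_derivative_at_withinI)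
      show "\<forall>\<^sub>F n in sequentially. \<forall>y\<in>S. \<forall>h. norm ((\<Sum>m<n. \<Sum>i\<in>UNIV. h $ i *\<^sub>R D i (e m) y)
          - (\<Sum>i\<in>UNIV. h $ i *\<^sub>R G i y)) \<le> \<epsilon> * norm h" if "\<epsilon> > 0" for \<epsilon>
      proof -
        have "\<forall>\<^sub>F n in sequentially. \<forall>i. \<forall>y\<in>S. dist (\<Sum>m<n. D i (e m) y) (G i y) < \<epsilon> / CARD('d)"
          by (rule eventually_all_finite) (use uniform_limitD[OF lim] \<open>\<epsilon> > 0\<close> in simp)
        then show ?thesis
        proof eventually_elim
          case (elim n)
          show ?case
          proof (intro ballI allI)
            fix y h assume "y \<in> S"
            have "(\<Sum>m<n. \<Sum>i\<in>UNIV. h $ i *\<^sub>R D i (e m) y) - (\<Sum>i\<in>UNIV. h $ i *\<^sub>R G i y)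
                = (\<Sum>i\<in>UNIV. h $ i *\<^sub>R ((\<Sum>m<n. D i (e m) y) - G i y))"
              by (subst sum.swap) (simp add: scaleR_diff_right scaleR_sum_right sum_subtractf)
            also have "norm \<dots> \<le> (\<Sum>i\<in>(UNIV :: 'd set). norm h * (\<epsilon> / CARD('d)))"
            proof (rule sum_norm_le)
              fix i :: 'd
              show "norm (h $ i *\<^sub>R ((\<Sum>m<n. D i (e m) y) - G i y)) \<le> norm h * (\<epsilon> / CARD('d))"
                using mult_mono[OF component_le_norm_cart[of h i]
                    less_imp_le[OF elim[rule_format, OF \<open>y \<in> S\<close>, of i]]]
                by (simp add: dist_norm)
            qed
            also have "\<dots> = \<epsilon> * norm h" by simp
            finally show "norm ((\<Sum>m<n. \<Sum>i\<in>UNIV. h $ i *\<^sub>R D i (e m) y)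
              - (\<Sum>i\<in>UNIV. h $ i *\<^sub>R G i y)) \<le> \<epsilon> * norm h" .
          qed
        qed
      qed
    qed
    then obtain g where g: "\<And>y. y \<in> S \<Longrightarrow>
        (\<lambda>n. (\<Prod>i\<in>UNIV. (y $ i - x $ i) ^ e n i) *\<^sub>R c (e n)) sums g y"
        "\<And>y. y \<in> S \<Longrightarrow> (g has_derivative (\<lambda>h. \<Sum>i\<in>UNIV. h $ i *\<^sub>R G i y)) (at y within S)"
      by blast
    \<comment> \<open>The limit \<open>g\<close> comes from an existence statement; uniqueness of
      sums identifies it with \<open>f\<close> on \<open>S\<close>.\<close>
    have "g z = f z" if "z \<in> S" for z
      using sums_unique2[OF g(1)[OF that] e_sums[OF series]] SS that by auto
    then show ?thesis
      using has_derivative_transform_within_open[OF g(2)[OF y, unfolded at_within_open[OF y open_open_cube[of x "r/4", folded S_def]]]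
          open_open_cube[of x "r/4", folded S_def] y] by blast
  qed
  have "\<exists>c'. \<forall>y\<in>S. ((\<lambda>\<alpha>. (\<Prod>i\<in>UNIV. (y $ i - x $ i) ^ \<alpha> i) *\<^sub>R c' \<alpha>) has_sum G i y) UNIV" for i
  proof (intro exI ballI)
    fix y assume y: "y \<in> S"
    \<comment> \<open>Index shift: terms with \<open>\<alpha> i = 0\<close> vanish under the i-th
      partial, and \<open>up\<close> reaches exactly the other exponents. The new coefficient at
      \<alpha> is \<open>Suc (\<alpha> i)\<close> times the old one at
      \<open>up \<alpha>\<close>.\<close>
    define up where "up \<alpha> = \<alpha>(i := Suc (\<alpha> i))" for \<alpha> :: "'d \<Rightarrow> nat"
    have "inj up"
    proof (rule injI)
      fix \<alpha> \<beta> assume "up \<alpha> = up \<beta>"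
      then have "up \<alpha> j = up \<beta> j" for j by simp
      then show "\<alpha> = \<beta>" by (auto simp: up_def fun_eq_iff split: if_splits) (metis nat.inject)
    qed
    have "((\<lambda>\<alpha>. D i \<alpha> y) has_sum G i y) (range up)"
    proof (rule has_sum_cong_neutral[THEN iffD1, OF _ _ _ D_sum[OF y]])
      fix \<alpha> assume "\<alpha> \<in> UNIV - range up"
      then have "\<alpha> \<noteq> up (\<alpha>(i := \<alpha> i - 1))" by blast
      then have "\<alpha> i = 0" by (auto simp: up_def fun_eq_iff split: if_splits)
      then show "D i \<alpha> y = 0" by (simp add: D_def monomial_deriv_def)
    qed auto
    then have *: "((\<lambda>\<alpha>. D i (up \<alpha>) y) has_sum G i y) UNIV"
      using has_sum_reindex[OF \<open>inj up\<close>, of "\<lambda>\<alpha>. D i \<alpha> y"] by (simp add: o_def)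
    have "monomial_deriv i (up \<alpha>) (y - x) = (\<Prod>i\<in>UNIV. (y $ i - x $ i) ^ \<alpha> i) * real (Suc (\<alpha> i))" for \<alpha>
    proof -
      have "(\<Prod>j\<in>UNIV - {i}. (y $ j - x $ j) ^ up \<alpha> j) = (\<Prod>j\<in>UNIV - {i}. (y $ j - x $ j) ^ \<alpha> j)"
        by (rule prod.cong) (auto simp: up_def)
      then show ?thesis
        by (simp add: monomial_deriv_def prod.remove[of UNIV i] up_def mult_ac del: of_nat_Suc)
    qed
    then have "D i (up \<alpha>) y = (\<Prod>i\<in>UNIV. (y $ i - x $ i) ^ \<alpha> i) *\<^sub>R (real (Suc (\<alpha> i)) *\<^sub>R c (up \<alpha>))" for \<alpha>
      by (simp add: D_def)
    with * show "((\<lambda>\<alpha>. (\<Prod>i\<in>UNIV. (y $ i - x $ i) ^ \<alpha> i) *\<^sub>R (real (Suc (\<alpha> i)) *\<^sub>R c (\<alpha>(i := Suc (\<alpha> i)))))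
        has_sum G i y) UNIV" by (simp add: up_def)
  qed
  with deriv show ?thesis by (intro that[of G]) (auto simp: S_def)
qed

text \<open>Each differentiation shrinks the cube by 4. Continuity at order 0 is itself obtained
  from differentiability, hence the exponent \<open>Suc k\<close>.\<close>

lemma power_series_cont_diff_on:
  fixes f :: "real ^ 'd \<Rightarrow> 'b::euclidean_space"
  assumes "r > 0" "\<forall>y\<in>open_cube x r.
      ((\<lambda>\<alpha>. (\<Prod>i\<in>UNIV. (y $ i - x $ i) ^ \<alpha> i) *\<^sub>R c \<alpha>) has_sum f y) UNIV"
  shows "cont_diff_on k f (open_cube x (r / 4 ^ Suc k))"
  using assms
proof (induction k arbitrary: r c f)
  case 0
  show ?case
  proof (rule power_series_deriv[OF 0(1) 0(2)[rule_format]])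
    fix G :: "'d \<Rightarrow> real ^ 'd \<Rightarrow> 'b"
    assume "\<And>y. y \<in> open_cube x (r / 4) \<Longrightarrow>
      (f has_derivative (\<lambda>h. \<Sum>i\<in>UNIV. h $ i *\<^sub>R G i y)) (at y)"
    then have "f differentiable_on open_cube x (r / 4)"
      unfolding differentiable_on_def by (blast intro: differentiableI differentiable_at_withinI)
    then show ?thesis by (simp add: differentiable_imp_continuous_on)
  qed
next
  case (Suc k)
  show ?case
  proof (rule power_series_deriv[OF Suc.prems(1) Suc.prems(2)[rule_format]])
    fix G
    assume G: "\<And>y. y \<in> open_cube x (r / 4) \<Longrightarrow> (f has_derivative (\<lambda>h. \<Sum>i\<in>UNIV. h $ i *\<^sub>R G i y)) (at y)"
      "\<And>i. \<exists>c'. \<forall>y\<in>open_cube x (r / 4).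
        ((\<lambda>\<alpha>. (\<Prod>i\<in>UNIV. (y $ i - x $ i) ^ \<alpha> i) *\<^sub>R c' \<alpha>) has_sum G i y) UNIV"
    have "(1::real) \<le> 4 * 4 ^ k" using one_le_power[of "4::real" k] by linarith
    then have "r / 4 ^ Suc (Suc k) \<le> r / 4"
      using \<open>r > 0\<close> by (simp add: field_simps)
    then have sub: "open_cube x (r / 4 ^ Suc (Suc k)) \<subseteq> open_cube x (r / 4)"
      by (rule open_cube_mono)
    show ?thesis
    proof (rule cont_diff_on_SucI[OF open_open_cube G(1)])
      fix i
      obtain c' where "\<forall>y\<in>open_cube x (r / 4).
        ((\<lambda>\<alpha>. (\<Prod>i\<in>UNIV. (y $ i - x $ i) ^ \<alpha> i) *\<^sub>R c' \<alpha>) has_sum G i y) UNIV"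
        using G(2) by blast
      then have "cont_diff_on k (G i) (open_cube x (r / 4 / 4 ^ Suc k))"
        using Suc.prems by (intro Suc.IH) auto
      then show "cont_diff_on k (\<lambda>y. \<Sum>j\<in>UNIV. axis i 1 $ j *\<^sub>R G j y) (open_cube x (r / 4 ^ Suc (Suc k)))"
        unfolding sum_axis_scaleR by simp
    qed (use sub in auto)
  qed
qed

lemma real_analytic_at_imp_cont_diff_on:
  fixes f :: "real ^ 'd \<Rightarrow> 'b::euclidean_space"
  assumes "real_analytic_at f x"
  obtains U where "open U" "x \<in> U" "cont_diff_on k f U"
proof -
  obtain r c where r: "r > 0" and c: "\<forall>y\<in>ball x r.
     ((\<lambda>\<alpha>. (\<Prod>i\<in>UNIV. (y $ i - x $ i) ^ \<alpha> i) *\<^sub>R c \<alpha>) has_sum f y) UNIV"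
    using assms unfolding real_analytic_at_def by blast
  \<comment> \<open>The Euclidean norm is at most the sum of the absolute coordinates, so dividing
    by the dimension fits the cube into the ball.\<close>
  define s where "s = r / CARD('d)"
  have "s > 0" using r by (simp add: s_def)
  have "open_cube x s \<subseteq> ball x r"
  proof
    fix y assume "y \<in> open_cube x s"
    then have "(\<Sum>i\<in>UNIV. \<bar>(y - x) $ i\<bar>) < (\<Sum>i\<in>(UNIV :: 'd set). s)"
      by (intro sum_strict_mono) (auto simp: open_cube_def)
    then show "y \<in> ball x r"
      using norm_le_l1_cart[of "y - x"] by (simp add: s_def dist_norm norm_minus_commute)
  qed
  with c have "cont_diff_on k f (open_cube x (s / 4 ^ Suc k))"
    by (intro power_series_cont_diff_on[OF \<open>s > 0\<close>]) auto
  moreover have "x \<in> open_cube x (s / 4 ^ Suc k)" using \<open>s > 0\<close> by (simp add: open_cube_def)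
  ultimately show ?thesis using that open_open_cube by blast
qed

subsection \<open>Extreme eigenvalues of self-adjoint matrices\<close>

text \<open>A maximiser of the Rayleigh quotient on the compact unit sphere is an eigenvector: its
  first variation in every direction must vanish.\<close>

lemma selfadjoint_max_eigenvector:
  fixes f :: "'a::euclidean_space \<Rightarrow> 'a"
  assumes "linear f" and sa: "\<And>v w. f v \<bullet> w = v \<bullet> f w"
  obtains v r where "v \<noteq> 0" "f v = r *\<^sub>R v" "\<And>w. f w \<bullet> w \<le> r * (w \<bullet> w)"
proof -
  interpret linear f by fact
  have "continuous_on (sphere 0 1) (\<lambda>v. f v \<bullet> v)"
    using \<open>linear f\<close> by (intro continuous_intros linear_continuous_on) (simp add: linear_conv_bounded_linear)
  moreover have "sphere (0::'a) 1 \<noteq> {}" by simp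
  ultimately obtain v where v: "norm v = 1" and max: "\<And>w. norm w = 1 \<Longrightarrow> f w \<bullet> w \<le> f v \<bullet> v"
    using continuous_attains_sup[of "sphere (0::'a) 1" "\<lambda>v. f v \<bullet> v"] by auto
  define r where "r = f v \<bullet> v"
  have bound: "f w \<bullet> w \<le> r * (w \<bullet> w)" for w
  proof (cases "w = 0")
    case False
    then have "f ((1 / norm w) *\<^sub>R w) \<bullet> ((1 / norm w) *\<^sub>R w) \<le> r"
      unfolding r_def by (intro max) simp
    then show ?thesis using False
      by (simp add: scaleR power2_norm_eq_inner[symmetric] power2_eq_square field_simps)
  qed simp
  have orth: "(r *\<^sub>R v - f v) \<bullet> u = 0" for u
  proof (rule ccontr)
    assume ne: "(r *\<^sub>R v - f v) \<bullet> u \<noteq> 0"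
    define a where "a = (r *\<^sub>R v - f v) \<bullet> u"
    define b where "b = r * (u \<bullet> u) - f u \<bullet> u"
    have vv: "v \<bullet> v = 1" using v by (simp add: norm_eq_1)
    have pos: "0 \<le> 2 * t * a + t\<^sup>2 * b" for t
    proof -
      have "f u \<bullet> v = f v \<bullet> u" by (metis sa inner_commute)
      with bound[of "v + t *\<^sub>R u"] vv show ?thesis
        by (simp add: add scaleR a_def b_def r_def[symmetric] inner_add_left inner_add_right inner_diff_left
            power2_eq_square algebra_simps inner_commute[of u v])
    qed
    have "b \<ge> 0" using bound[of u] by (simp add: b_def)
    \<comment> \<open>Dividing by b + 1 instead of b gives a negative value also when b = 0.\<close>
    define t where "t = - a / (b + 1)"
    have "2 * t * a + t\<^sup>2 * b = - a\<^sup>2 * (b + 2) / (b + 1)\<^sup>2"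
    proof -
      define d where "d = b + 1"
      have "d \<noteq> 0" "b = d - 1" using \<open>b \<ge> 0\<close> by (auto simp: d_def)
      then show ?thesis unfolding t_def \<open>b = d - 1\<close> by (simp add: field_simps power2_eq_square)
    qed
    also have "\<dots> < 0"
      using \<open>b \<ge> 0\<close> ne by (simp add: a_def divide_neg_pos mult_neg_pos)
    finally show False using pos[of t] by simp
  qed
  from orth[of "r *\<^sub>R v - f v"] have "f v = r *\<^sub>R v" by simp
  moreover have "v \<noteq> 0" using v by auto
  ultimately show ?thesis using bound that by blast
qed

text \<open>Eigenvectors for distinct eigenvalues are orthogonal, hence independent, and the
  dimension bounds their number.\<close>

lemma selfadjoint_finite_eigenvalues:
  fixes f :: "'a::euclidean_space \<Rightarrow> 'a"
  assumes sa: "\<And>v w. f v \<bullet> w = v \<bullet> f w"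
  shows "finite {r. \<exists>v. v \<noteq> 0 \<and> f v = r *\<^sub>R v}" (is "finite ?E")
proof -
  obtain e where e: "\<And>r. r \<in> ?E \<Longrightarrow> e r \<noteq> 0 \<and> f (e r) = r *\<^sub>R e r"
    using bchoice[of ?E "\<lambda>r v. v \<noteq> 0 \<and> f v = r *\<^sub>R v"] by auto
  have orth: "e r \<bullet> e s = 0" if "r \<in> ?E" "s \<in> ?E" "r \<noteq> s" for r s
    using sa[of "e r" "e s"] e[OF that(1)] e[OF that(2)] that(3) by simp
  have "inj_on e ?E"
  proof (rule inj_onI)
    fix r s assume "r \<in> ?E" "s \<in> ?E" "e r = e s"
    then show "r = s" using orth[of r s] e[of r] by auto
  qed
  moreover have "independent (e ` ?E)"
  proof (rule pairwise_orthogonal_independent)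
    show "pairwise orthogonal (e ` ?E)"
      unfolding pairwise_def orthogonal_def using orth by blast
    show "0 \<notin> e ` ?E" using e by force
  qed
  ultimately show ?thesis using independent_bound finite_imageD by blast
qed

lemma is_eigenvalue_of_real:
  fixes M :: "'a::real_field ^ 'n ^ 'n"
  shows "is_eigenvalue M (of_real r) \<longleftrightarrow> (\<exists>v. v \<noteq> 0 \<and> M *v v = r *\<^sub>R v)"
proof -
  have "of_real r *s v = r *\<^sub>R v" for v :: "'a ^ 'n"
    by (simp add: vec_eq_iff) (simp add: scaleR_conv_of_real)
  then show ?thesis by (simp add: is_eigenvalue_def)
qed

text \<open>\<open>Max\<close> and \<open>Min\<close> are informative only for a finite nonempty
  set. The type class covers real symmetric and complex Hermitian matrices at once.\<close>

lemma
  fixes M :: "'a::{real_field,euclidean_space} ^ 'n ^ 'n"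
  assumes sa: "\<And>v w. (M *v v) \<bullet> w = v \<bullet> (M *v w)"
  shows finite_real_eigenvalues: "finite {r. is_eigenvalue M (of_real r)}"
    and lambda_max_eigenvector: "\<exists>v. v \<noteq> 0 \<and> M *v v = lambda_max M *\<^sub>R v"
    and lambda_max_rayleigh: "(M *v w) \<bullet> w \<le> lambda_max M * (w \<bullet> w)"
    and lambda_min_eigenvector: "\<exists>v. v \<noteq> 0 \<and> M *v v = lambda_min M *\<^sub>R v"
    and lambda_min_rayleigh: "lambda_min M * (w \<bullet> w) \<le> (M *v w) \<bullet> w"
proof -
  let ?E = "{r. is_eigenvalue M (of_real r)}"
  have lin: "linear ((*v) M)" by (rule bounded_linear.linear) simp
  show fin: "finite ?E"
    using selfadjoint_finite_eigenvalues[OF sa] by (simp add: is_eigenvalue_of_real)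
  obtain v r where v: "v \<noteq> 0" "M *v v = r *\<^sub>R v" "\<And>w. (M *v w) \<bullet> w \<le> r * (w \<bullet> w)"
    using selfadjoint_max_eigenvector[OF lin sa] by metis
  then have "r \<in> ?E" by (auto simp: is_eigenvalue_of_real)
  then have "lambda_max M \<in> ?E" "r \<le> lambda_max M"
    unfolding lambda_max_def using fin Max_in Max_ge by (blast, blast)
  then show "\<exists>v. v \<noteq> 0 \<and> M *v v = lambda_max M *\<^sub>R v"
    by (simp add: is_eigenvalue_of_real)
  show "(M *v w) \<bullet> w \<le> lambda_max M * (w \<bullet> w)"
    using v(3)[of w] mult_right_mono[OF \<open>r \<le> lambda_max M\<close> inner_ge_zero[of w]] by linarith
  \<comment> \<open>The statements on the minimum come from the maximal eigenvector of -M.\<close>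
  have "linear (\<lambda>v. - (M *v v))" "\<And>v w. - (M *v v) \<bullet> w = v \<bullet> - (M *v w)"
    using lin by (simp_all add: linear_compose_neg sa)
  then obtain u s where u: "u \<noteq> 0" "- (M *v u) = s *\<^sub>R u" "\<And>w. - (M *v w) \<bullet> w \<le> s * (w \<bullet> w)"
    using selfadjoint_max_eigenvector[of "\<lambda>v. - (M *v v)"] by metis
  then have "M *v u = (- s) *\<^sub>R u" by (metis minus_minus scaleR_minus_left)
  then have "- s \<in> ?E" using u(1) by (auto simp: is_eigenvalue_of_real simp del: of_real_minus)
  then have "lambda_min M \<in> ?E" "lambda_min M \<le> - s"
    unfolding lambda_min_def using fin Min_in Min_le by (blast, blast)
  then show "\<exists>v. v \<noteq> 0 \<and> M *v v = lambda_min M *\<^sub>R v"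
    by (simp add: is_eigenvalue_of_real)
  show "lambda_min M * (w \<bullet> w) \<le> (M *v w) \<bullet> w"
    using u(3)[of w] mult_right_mono[OF \<open>lambda_min M \<le> - s\<close> inner_ge_zero[of w]] by simp
qed

lemma inner_complex_mult_left: "(a * b) \<bullet> (c :: complex) = b \<bullet> (cnj a * c)"
  by (simp add: inner_complex_def algebra_simps)

text \<open>With respect to the real inner product on the complex plane, the adjoint of
  multiplication by a is multiplication by its conjugate.\<close>

lemma hermitian_selfadjoint:
  assumes "hermitian M"
  shows "(M *v v) \<bullet> w = v \<bullet> (M *v w)"
proof -
  have "cnj (M $ i $ j) = M $ j $ i" for i j
    using assms unfolding hermitian_def by metis
  then have "(M *v v) \<bullet> w = (\<Sum>i\<in>UNIV. \<Sum>j\<in>UNIV. v $ j \<bullet> (M $ j $ i * w $ i))"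
    by (simp add: inner_vec_def matrix_vector_mult_def inner_sum_left inner_complex_mult_left)
  also have "\<dots> = v \<bullet> (M *v w)"
    by (subst sum.swap) (simp add: inner_vec_def matrix_vector_mult_def inner_sum_right)
  finally show ?thesis .
qed

lemma symmetric_selfadjoint:
  fixes M :: "real ^ 'n ^ 'n"
  assumes "\<And>i j. M $ i $ j = M $ j $ i"
  shows "(M *v v) \<bullet> w = v \<bullet> (M *v w)"
proof -
  have "transpose M = M" using assms by (simp add: transpose_def vec_eq_iff)
  then show ?thesis by (metis dot_lmul_matrix transpose_matrix_vector)
qed

section \<open>Continuity of the smallest eigenvalue\<close>

lemma norm_matrix_vector_le:
  fixes M :: "complex ^ 'n ^ 'm"
  shows "norm (M *v v) \<le> real CARD('m) * real CARD('n) * norm M * norm v"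
proof -
  have "norm ((M *v v) $ i) \<le> real CARD('n) * (norm M * norm v)" for i
  proof -
    have "norm (\<Sum>j\<in>UNIV. M $ i $ j * v $ j) \<le> (\<Sum>j\<in>(UNIV :: 'n set). norm M * norm v)"
    proof (rule sum_norm_le)
      fix j
      have "norm (M $ i $ j) \<le> norm M"
        by (rule order_trans[OF Finite_Cartesian_Product.norm_nth_le Finite_Cartesian_Product.norm_nth_le])
      then show "norm (M $ i $ j * v $ j) \<le> norm M * norm v"
        by (simp add: norm_mult mult_mono Finite_Cartesian_Product.norm_nth_le)
    qed
    then show ?thesis by (simp add: matrix_vector_mult_def)
  qed
  then have "(\<Sum>i\<in>UNIV. norm ((M *v v) $ i)) \<le> (\<Sum>i\<in>(UNIV :: 'm set). real CARD('n) * (norm M * norm v))"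
    by (intro sum_mono)
  moreover have "norm (M *v v) \<le> (\<Sum>i\<in>UNIV. norm ((M *v v) $ i))"
    unfolding norm_vec_def by (rule L2_set_le_sum) simp
  ultimately show ?thesis by (simp add: mult_ac)
qed

lemma bounded_linear_quadratic_form:
  fixes v :: "complex ^ 'n"
  shows "bounded_linear (\<lambda>M :: complex ^ 'n ^ 'n. (M *v v) \<bullet> v)"
proof (rule bounded_linear_compose[OF bounded_linear_inner_left])
  show "bounded_linear (\<lambda>M :: complex ^ 'n ^ 'n. M *v v)"
  proof (rule bounded_linear_intro)
    show "norm (M *v v) \<le> norm M * (real CARD('n) * real CARD('n) * norm v)" for M :: "complex ^ 'n ^ 'n"
      using norm_matrix_vector_le[of M v] by (simp add: mult_ac)
  qed (simp_all add: vec_eq_iff matrix_vector_mult_def sum.distrib scaleR_sum_right algebra_simps)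
qed

text \<open>Testing M with a lowest eigenvector of N bounds \<open>lambda_min M\<close> from above
  by \<open>lambda_min N\<close> plus a multiple of the norm of M - N; exchanging the roles gives
  the other side. The constant is crude, but any constant yields continuity.\<close>

lemma lambda_min_lipschitz:
  fixes M N :: "complex ^ 'n ^ 'n"
  assumes "hermitian M" "hermitian N"
  shows "\<bar>lambda_min M - lambda_min N\<bar> \<le> real CARD('n) * real CARD('n) * norm (M - N)"
proof -
  have *: "lambda_min M \<le> lambda_min N + real CARD('n) * real CARD('n) * norm (M - N)"
    if M: "hermitian M" and N: "hermitian N" for M N :: "complex ^ 'n ^ 'n"
  proof -
    obtain u where u: "u \<noteq> 0" "N *v u = lambda_min N *\<^sub>R u"
      using lambda_min_eigenvector[OF hermitian_selfadjoint[OF N]] by blast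
    have "((M - N) *v u) \<bullet> u \<le> norm ((M - N) *v u) * norm u" by (rule norm_cauchy_schwarz)
    also have "\<dots> \<le> real CARD('n) * real CARD('n) * norm (M - N) * norm u * norm u"
      by (intro mult_right_mono norm_matrix_vector_le) simp
    also have "\<dots> = real CARD('n) * real CARD('n) * norm (M - N) * (u \<bullet> u)"
      by (simp add: power2_norm_eq_inner[symmetric] power2_eq_square)
    finally have "lambda_min M * (u \<bullet> u) \<le>
        (lambda_min N + real CARD('n) * real CARD('n) * norm (M - N)) * (u \<bullet> u)"
      using lambda_min_rayleigh[OF hermitian_selfadjoint[OF M], of u] u(2)
      by (simp add: matrix_vector_mult_diff_rdistrib inner_diff_left algebra_simps)
    then show ?thesis using u(1) by simp
  qed
  from *[OF assms] *[OF assms(2,1)] show ?thesis by (simp add: norm_minus_commute abs_le_iff)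
qed

lemma continuous_on_lambda_min:
  fixes A :: "'a::metric_space \<Rightarrow> complex ^ 'n ^ 'n"
  assumes "continuous_on U A" "\<And>x. x \<in> U \<Longrightarrow> hermitian (A x)"
  shows "continuous_on U (\<lambda>x. lambda_min (A x))"
  unfolding continuous_on_def
proof
  fix x assume "x \<in> U"
  have "((\<lambda>y. real CARD('n) * real CARD('n) * norm (A y - A x)) \<longlongrightarrow>
      real CARD('n) * real CARD('n) * norm (A x - A x)) (at x within U)"
    using assms(1) \<open>x \<in> U\<close> by (intro tendsto_intros) (simp add: continuous_on_def)
  then have lim: "((\<lambda>y. real CARD('n) * real CARD('n) * norm (A y - A x)) \<longlongrightarrow> 0) (at x within U)"
    by simp
  show "((\<lambda>x. lambda_min (A x)) \<longlongrightarrow> lambda_min (A x)) (at x within U)"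
  proof (rule Lim_transform_bound[OF _ lim, THEN Lim_null[THEN iffD2]])
    show "\<forall>\<^sub>F y in at x within U. norm (lambda_min (A y) - lambda_min (A x)) \<le>
        norm (real CARD('n) * real CARD('n) * norm (A y - A x))"
      unfolding eventually_at_filter
      using lambda_min_lipschitz[OF assms(2) assms(2)[OF \<open>x \<in> U\<close>]] by simp
  qed
qed

section \<open>The characteristic polynomial and its simple roots\<close>

lemma poly_charpoly: "poly (charpoly M) z = det (mat z - M)"
proof -
  have "poly ((mat [:0, 1:] - (\<chi> i j. [:M $ i $ j:])) $ i $ j) z = (mat z - M) $ i $ j" for i j
    by (simp add: mat_def)
  then show ?thesis
    unfolding charpoly_def det_def by (simp add: poly_sum poly_prod of_int_poly)
qed

lemma det_mat_diff_eq_0_iff: "det (mat z - M) = 0 \<longleftrightarrow> is_eigenvalue M z"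
proof -
  have "mat z *v v = z *s v" for v
    by (simp add: vec_eq_iff matrix_vector_mult_def mat_def if_distrib[of "\<lambda>a. a * _"] cong: if_cong)
  then have "(mat z - M) *v v = 0 \<longleftrightarrow> M *v v = z *s v" for v
    by (metis matrix_vector_mult_diff_rdistrib right_minus_eq)
  moreover have "det (mat z - M) \<noteq> 0 \<longleftrightarrow> (\<forall>v. (mat z - M) *v v = 0 \<longrightarrow> v = 0)"
    by (metis invertible_det_nz invertible_left_inverse matrix_left_invertible_ker)
  ultimately show ?thesis unfolding is_eigenvalue_def by blast
qed

lemma charpoly_root_iff: "poly (charpoly M) z = 0 \<longleftrightarrow> is_eigenvalue M z"
  by (simp add: poly_charpoly det_mat_diff_eq_0_iff)

lemma simple_eigenvalue_pderiv_nonzero: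
  fixes M :: "complex ^ 'n ^ 'n"
  assumes "hermitian M" "simple_eigenvalue M \<mu>"
  shows "poly (pderiv (charpoly M)) \<mu> \<noteq> 0"
proof -
  \<comment> \<open>A zero characteristic polynomial would make every real number an eigenvalue,
    against the finiteness of the spectrum.\<close>
  have "charpoly M \<noteq> 0"
  proof
    assume "charpoly M = 0"
    then have "{r. is_eigenvalue M (of_real r)} = UNIV"
      using charpoly_root_iff[of M] by auto
    with finite_real_eigenvalues[OF hermitian_selfadjoint[OF assms(1)]] show False
      by (simp add: infinite_UNIV_char_0)
  qed
  moreover have order: "order \<mu> (charpoly M) = 1" using assms(2) by (simp add: simple_eigenvalue_def)
  ultimately have "poly (charpoly M) \<mu> = 0" by (simp add: order_root)
  then have "order \<mu> (pderiv (charpoly M)) = 0"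
    using order_pderiv[OF \<open>charpoly M \<noteq> 0\<close>] order by simp
  \<comment> \<open>Order 0 excludes a root only for a nonzero polynomial; a constant
    \<open>charpoly M\<close> with the root \<mu> would be zero.\<close>
  moreover have "pderiv (charpoly M) \<noteq> 0"
  proof
    assume "pderiv (charpoly M) = 0"
    then obtain a where "charpoly M = [:a:]" using degree_eq_zeroE by (auto simp: pderiv_eq_0_iff)
    with \<open>poly (charpoly M) \<mu> = 0\<close> \<open>charpoly M \<noteq> 0\<close> show False by simp
  qed
  ultimately show ?thesis by (simp add: order_root)
qed

subsection \<open>Smooth dependence of a simple root\<close>

text \<open>The common degree bound lets evaluation and formal derivative be written as sums over
  one index range for all x.\<close>

definition poly_cont_diff_on :: "nat \<Rightarrow> (real ^ 'd \<Rightarrow> 'b::real_normed_field poly) \<Rightarrow> (real ^ 'd) set \<Rightarrow> bool" where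
  "poly_cont_diff_on k p U \<longleftrightarrow>
     (\<forall>j. cont_diff_on k (\<lambda>x. coeff (p x) j) U) \<and> (\<exists>N. \<forall>x. degree (p x) \<le> N)"

lemma poly_cont_diff_on_const: "open U \<Longrightarrow> poly_cont_diff_on k (\<lambda>x. q) U"
  by (auto simp: poly_cont_diff_on_def intro: cont_diff_on_const)

lemma poly_cont_diff_on_add:
  assumes "open U" "poly_cont_diff_on k p U" "poly_cont_diff_on k q U"
  shows "poly_cont_diff_on k (\<lambda>x. p x + q x) U"
proof -
  obtain M N where "\<And>x. degree (p x) \<le> M" "\<And>x. degree (q x) \<le> N"
    using assms by (auto simp: poly_cont_diff_on_def)
  then have "degree (p x + q x) \<le> max M N" for x
    by (meson degree_add_le max.coboundedI1 max.coboundedI2)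
  with assms show ?thesis
    by (auto simp: poly_cont_diff_on_def intro!: cont_diff_on_add)
qed

lemma poly_cont_diff_on_mult:
  assumes "open U" "poly_cont_diff_on k p U" "poly_cont_diff_on k q U"
  shows "poly_cont_diff_on k (\<lambda>x. p x * q x) U"
proof -
  obtain M N where "\<And>x. degree (p x) \<le> M" "\<And>x. degree (q x) \<le> N"
    using assms by (auto simp: poly_cont_diff_on_def)
  then have "degree (p x * q x) \<le> M + N" for x
    by (meson add_mono degree_mult_le order_trans)
  with assms show ?thesis
    by (auto simp: poly_cont_diff_on_def coeff_mult intro!: cont_diff_on_sum cont_diff_on_mult)
qed

lemma poly_cont_diff_on_sum:
  assumes "open U" "\<And>i. i \<in> I \<Longrightarrow> poly_cont_diff_on k (p i) U"
  shows "poly_cont_diff_on k (\<lambda>x. \<Sum>i\<in>I. p i x) U"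
  using assms(2)
  by (induction I rule: infinite_finite_induct)
    (auto simp: poly_cont_diff_on_const[OF assms(1)] intro!: poly_cont_diff_on_add[OF assms(1)])

lemma poly_cont_diff_on_prod:
  assumes "open U" "\<And>i. i \<in> I \<Longrightarrow> poly_cont_diff_on k (p i) U"
  shows "poly_cont_diff_on k (\<lambda>x. \<Prod>i\<in>I. p i x) U"
  using assms(2)
  by (induction I rule: infinite_finite_induct)
    (auto simp: poly_cont_diff_on_const[OF assms(1)] intro!: poly_cont_diff_on_mult[OF assms(1)])

lemma poly_cont_diff_on_charpoly:
  fixes A :: "real ^ 'd \<Rightarrow> complex ^ 'n ^ 'n"
  assumes "open U" "cont_diff_on k A U"
  shows "poly_cont_diff_on k (\<lambda>x. charpoly (A x)) U"
proof -
  have "poly_cont_diff_on k (\<lambda>x. (mat [:0, 1:] - (\<chi> i j. [:A x $ i $ j:])) $ i $ j) U" for i j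
  proof -
    have entry: "cont_diff_on k (\<lambda>x. - (A x $ i $ j)) U"
      by (rule cont_diff_on_bounded_linear[OF bounded_linear_minus[OF bounded_linear_compose[OF
              bounded_linear_vec_nth bounded_linear_vec_nth]] assms])
    have "poly_cont_diff_on k (\<lambda>x. [:- (A x $ i $ j):]) U"
      unfolding poly_cont_diff_on_def
    proof (intro conjI allI exI)
      show "cont_diff_on k (\<lambda>x. coeff [:- (A x $ i $ j):] n) U" for n
        using entry cont_diff_on_const[OF \<open>open U\<close>, of k 0] by (cases n) simp_all
      show "degree [:- (A x $ i $ j):] \<le> 0" for x by simp
    qed
    from poly_cont_diff_on_add[OF \<open>open U\<close> poly_cont_diff_on_const[OF \<open>open U\<close>] this]
    have "poly_cont_diff_on k (\<lambda>x. mat [:0, 1:] $ i $ j + [:- (A x $ i $ j):]) U" .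
    moreover have "mat [:0, 1:] $ i $ j + [:- (A x $ i $ j):] =
        (mat [:0, 1:] - (\<chi> i j. [:A x $ i $ j:])) $ i $ j" for x by simp
    ultimately show ?thesis by (simp only:)
  qed
  then show ?thesis
    unfolding charpoly_def det_def
    by (intro poly_cont_diff_on_sum poly_cont_diff_on_mult poly_cont_diff_on_prod
        poly_cont_diff_on_const assms(1))
qed

text \<open>Since g vanishes at x, g y is of the order of the distance from y to x, so multiplying
  it by the small difference r y - r x leaves no first-order term. This permits a factor that is
  merely continuous, such as one built from an eigenvalue whose differentiability is still to be
  shown.\<close>

lemma has_derivative_mult_at_zero:
  fixes g r :: "'a::real_normed_vector \<Rightarrow> 'b::real_normed_field"
  assumes g: "(g has_derivative g') (at x)" "g x = 0" and r: "isCont r x"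
  shows "((\<lambda>y. g y * r y) has_derivative (\<lambda>h. g' h * r x)) (at x)"
proof -
  have bl: "bounded_linear g'" using g(1) by (rule has_derivative_bounded_linear)
  then obtain K where K: "K > 0" "\<And>h. norm (g' h) \<le> norm h * K"
    using bounded_linear.pos_bounded by blast
  have alt: "\<And>e. e > 0 \<Longrightarrow> \<exists>d>0. \<forall>y. norm (y - x) < d \<longrightarrow> norm (g y - g' (y - x)) \<le> e * norm (y - x)"
    using g unfolding has_derivative_at_alt by simp
  obtain d1 where d1: "d1 > 0" "\<And>y. norm (y - x) < d1 \<Longrightarrow> norm (g y - g' (y - x)) \<le> 1 * norm (y - x)"
    using alt[of 1] by auto
  have g_le: "norm (g y) \<le> (K + 1) * norm (y - x)" if "norm (y - x) < d1" for y
    using d1(2)[OF that] K(2)[of "y - x"] norm_triangle_ineq[of "g y - g' (y - x)" "g' (y - x)"]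
    by (simp add: algebra_simps)
  have "((\<lambda>y. g y * (r y - r x)) has_derivative (\<lambda>h. 0)) (at x)"
    unfolding has_derivative_at_alt
  proof (intro conjI allI impI)
    fix e :: real assume "e > 0"
    then have "e / (K + 1) > 0" using K by simp
    then obtain d2 where d2: "d2 > 0" "\<And>y. dist y x < d2 \<Longrightarrow> dist (r y) (r x) < e / (K + 1)"
      using r unfolding continuous_at_eps_delta by blast
    show "\<exists>d>0. \<forall>y. norm (y - x) < d \<longrightarrow>
        norm (g y * (r y - r x) - g x * (r x - r x) - 0) \<le> e * norm (y - x)"
    proof (intro exI[of _ "min d1 d2"] conjI allI impI)
      fix y assume y: "norm (y - x) < min d1 d2"
      have "norm (g y * (r y - r x)) \<le> ((K + 1) * norm (y - x)) * (e / (K + 1))"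
        unfolding norm_mult
        using g_le[of y] d2(2)[of y] y K by (intro mult_mono) (auto simp: dist_norm)
      also have "\<dots> = e * norm (y - x)" using K by simp
      finally show "norm (g y * (r y - r x) - g x * (r x - r x) - 0) \<le> e * norm (y - x)" by simp
    qed (use d1 d2 in auto)
  qed simp
  from has_derivative_add[OF has_derivative_mult_left[OF g(1), of "r x"] this] show ?thesis
    by (simp add: algebra_simps)
qed

lemma poly_eq_sum_le:
  fixes p :: "'a::comm_semiring_1 poly"
  assumes "degree p \<le> N"
  shows "poly p z = (\<Sum>j\<le>N. coeff p j * z ^ j)"
  by (subst poly_as_sum_of_monoms'[OF assms, symmetric]) (simp add: poly_sum poly_monom)

lemma poly_pderiv_eq_sum_le:
  fixes p :: "'a::idom poly"
  assumes "degree p \<le> N"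
  shows "poly (pderiv p) z = (\<Sum>j\<le>N. coeff p j * (of_nat j * z ^ (j - 1)))"
proof -
  have pderiv_sum: "pderiv (\<Sum>j\<in>J. q j) = (\<Sum>j\<in>J. pderiv (q j))" for q :: "nat \<Rightarrow> 'a poly" and J
    by (induction J rule: infinite_finite_induct) (simp_all add: pderiv_add)
  show ?thesis
    by (subst poly_as_sum_of_monoms'[OF assms, symmetric])
      (simp add: pderiv_sum pderiv_monom poly_sum poly_monom mult_ac)
qed

text \<open>Writing \<open>p y (L y) - p y (L x) = (L y - L x) * Q y\<close> turns the root equation into
  \<open>L y = L x - p y (L x) / Q y\<close>, and \<open>Q\<close> is continuous as soon as \<open>L\<close> is.\<close>

lemma has_derivative_root:
  fixes p :: "real ^ 'd \<Rightarrow> 'b::real_normed_field poly"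
  assumes "open U" "x \<in> U" and N: "\<And>y. degree (p y) \<le> N"
    and c': "\<And>j. ((\<lambda>y. coeff (p y) j) has_derivative c' j) (at x)"
    and L: "continuous_on U L" and root: "\<And>y. y \<in> U \<Longrightarrow> poly (p y) (L y) = 0"
    and nz: "poly (pderiv (p x)) (L x) \<noteq> 0"
  shows "(L has_derivative (\<lambda>h. - ((\<Sum>j\<le>N. c' j h * L x ^ j) * inverse (poly (pderiv (p x)) (L x))))) (at x)"
proof -
  define Q where "Q y = (\<Sum>j\<le>N. coeff (p y) j * (\<Sum>i<j. L x ^ (j - Suc i) * L y ^ i))" for y
  define g where "g y = poly (p y) (L x)" for y
  have contL: "isCont L x" using L assms(1,2) by (simp add: continuous_on_eq_continuous_at)
  have "isCont (\<lambda>y. coeff (p y) j) x" for j using has_derivative_continuous[OF c'] .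
  then have Q_cont: "isCont Q x"
    unfolding Q_def using contL by (intro continuous_intros)
  \<comment> \<open>On the diagonal the j summands of the divided difference coincide, so
    \<open>Q x\<close> is the formal derivative at the root.\<close>
  have "(\<Sum>i<j. L x ^ (j - Suc i) * L x ^ i) = of_nat j * L x ^ (j - 1)" for j
    by (simp flip: power_add)
  then have Qx: "Q x = poly (pderiv (p x)) (L x)"
    by (simp add: Q_def poly_pderiv_eq_sum_le[OF N])
  have diff: "- g y = (L y - L x) * Q y" if "y \<in> U" for y
  proof -
    have "- g y = poly (p y) (L y) - poly (p y) (L x)" using root[OF that] by (simp add: g_def)
    also have "\<dots> = (L y - L x) * Q y"
      by (simp add: Q_def poly_eq_sum_le[OF N] sum_subtractf[symmetric] sum_distrib_left
          right_diff_distrib[symmetric] power_diff_sumr2 mult_ac)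
    finally show ?thesis .
  qed
  have "(g has_derivative (\<lambda>h. \<Sum>j\<le>N. c' j h * L x ^ j)) (at x)"
    unfolding g_def poly_eq_sum_le[OF N] by (intro has_derivative_sum has_derivative_mult_left c')
  moreover have "g x = 0" using root[OF \<open>x \<in> U\<close>] by (simp add: g_def)
  moreover have "Q x \<noteq> 0" using Qx nz by metis
  then have "isCont (\<lambda>y. inverse (Q y)) x" using Q_cont by (intro continuous_intros)
  ultimately have "((\<lambda>y. g y * inverse (Q y)) has_derivative
      (\<lambda>h. (\<Sum>j\<le>N. c' j h * L x ^ j) * inverse (Q x))) (at x)"
    by (rule has_derivative_mult_at_zero)
  from has_derivative_add[OF has_derivative_const[of "L x"] has_derivative_minus[OF this]]
  have deriv: "((\<lambda>y. L x + - (g y * inverse (Q y))) has_derivative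
      (\<lambda>h. - ((\<Sum>j\<le>N. c' j h * L x ^ j) * inverse (Q x)))) (at x)" by simp
  have ev: "\<forall>\<^sub>F y in at x. L x + - (g y * inverse (Q y)) = L y"
  proof -
    have "\<forall>\<^sub>F y in at x. Q y \<noteq> 0"
      using tendsto_imp_eventually_ne[OF Q_cont[unfolded isCont_def]] Qx nz by simp
    moreover have "\<forall>\<^sub>F y in at x. y \<in> U" using assms(1,2) by (simp add: eventually_at_in_open')
    ultimately show ?thesis
    proof eventually_elim
      case (elim y)
      then show ?case using diff[of y]
        by (metis add.commute diff_add_cancel minus_mult_left mult.assoc right_inverse mult.right_neutral)
    qed
  qed
  \<comment> \<open>The two functions agree near x by \<open>ev\<close>, and at x itself because
    \<open>g x = 0\<close>.\<close>
  show ?thesis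
    using has_derivative_transform_eventually[OF deriv ev] \<open>g x = 0\<close> unfolding Qx by simp
qed

text \<open>A bootstrap: the derivative of the root is a rational expression in the root and in
  coefficients and their partials, so order \<open>k\<close> of the root lifts it to order
  \<open>Suc k\<close>.\<close>

lemma cont_diff_on_root:
  fixes p :: "real ^ 'd \<Rightarrow> 'b::real_normed_field poly"
  assumes U: "open U" and p: "poly_cont_diff_on k p U"
    and L: "continuous_on U L" and root: "\<And>y. y \<in> U \<Longrightarrow> poly (p y) (L y) = 0"
    and nz: "\<And>x. x \<in> U \<Longrightarrow> poly (pderiv (p x)) (L x) \<noteq> 0"
  shows "cont_diff_on k L U"
  using p
proof (induction k)
  case 0
  then show ?case using L by simp
next
  case (Suc k)
  obtain N where N: "\<And>x. degree (p x) \<le> N" using Suc.prems by (auto simp: poly_cont_diff_on_def)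
  have c: "cont_diff_on (Suc k) (\<lambda>y. coeff (p y) j) U" for j
    using Suc.prems by (simp add: poly_cont_diff_on_def del: cont_diff_on.simps)
  have ck: "cont_diff_on k (\<lambda>y. coeff (p y) j) U" for j
    by (rule cont_diff_on_Suc[OF c])
  have Lk: "cont_diff_on k L U"
    using Suc.IH ck N by (auto simp: poly_cont_diff_on_def)
  define c' where "c' j x h = (\<Sum>i\<in>UNIV. h $ i *\<^sub>R partial_derivative i (\<lambda>y. coeff (p y) j) x)" for j x h
  have c': "((\<lambda>y. coeff (p y) j) has_derivative c' j x) (at x)" if "x \<in> U" for j x
    unfolding c'_def using c[of j] that by (intro has_derivative_partial) simp
  show ?case
  proof (rule cont_diff_on_SucI[OF U has_derivative_root[OF U _ N c' L root nz]])
    fix i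
    have pd: "cont_diff_on k (\<lambda>x. c' j x (axis i 1)) U" for j
      unfolding c'_def sum_axis_scaleR using c[of j] by simp
    have pderiv: "cont_diff_on k (\<lambda>x. poly (pderiv (p x)) (L x)) U"
      unfolding poly_pderiv_eq_sum_le[OF N]
      by (intro cont_diff_on_sum cont_diff_on_mult cont_diff_on_power cont_diff_on_const U ck Lk)
    show "cont_diff_on k (\<lambda>x. - ((\<Sum>j\<le>N. c' j x (axis i 1) * L x ^ j) *
        inverse (poly (pderiv (p x)) (L x)))) U"
      by (intro cont_diff_on_bounded_linear[OF bounded_linear_minus[OF bounded_linear_ident]]
          cont_diff_on_sum cont_diff_on_mult cont_diff_on_power cont_diff_on_inverse U pd Lk pderiv nz)
  qed
qed

text \<open>Simplicity is given at \<omega> alone; the derivative of the characteristic polynomial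
  at the eigenvalue is continuous, so it stays nonzero on a neighbourhood. The root is handled as a
  complex number, and \<open>Re\<close> returns to the real function.\<close>

lemma lambda_min_cont_diff_on:
  fixes A :: "real ^ 'd \<Rightarrow> complex ^ 'n ^ 'n"
  assumes herm: "\<And>x. hermitian (A x)" and V: "open V" "\<omega> \<in> V" "cont_diff_on k A V"
    and simple: "simple_eigenvalue (A \<omega>) (of_real (lambda_min (A \<omega>)))"
  obtains U where "open U" "\<omega> \<in> U" "U \<subseteq> V" "cont_diff_on k (\<lambda>x. lambda_min (A x)) U"
proof -
  define L where "L x = complex_of_real (lambda_min (A x))" for x
  have L: "continuous_on V L" unfolding L_def
    by (intro continuous_on_of_real continuous_on_lambda_min herm cont_diff_on_imp_continuous_on[OF V(3)])
  have root: "poly (charpoly (A x)) (L x) = 0" for x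
    using lambda_min_eigenvector[OF hermitian_selfadjoint[OF herm[of x]]]
    by (simp add: charpoly_root_iff L_def is_eigenvalue_of_real)
  have char: "poly_cont_diff_on k (\<lambda>x. charpoly (A x)) V"
    by (rule poly_cont_diff_on_charpoly[OF V(1,3)])
  then obtain N where N: "\<And>x. degree (charpoly (A x)) \<le> N" by (auto simp: poly_cont_diff_on_def)
  define D where "D x = poly (pderiv (charpoly (A x))) (L x)" for x
  have "continuous_on V (\<lambda>x. coeff (charpoly (A x)) j)" for j
    using char by (auto simp: poly_cont_diff_on_def intro: cont_diff_on_imp_continuous_on)
  then have "continuous_on V D"
    unfolding D_def poly_pderiv_eq_sum_le[OF N] using L by (intro continuous_intros)
  then have "open (V \<inter> D -` (- {0}))" using V(1) by (intro continuous_open_preimage) auto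
  moreover have "\<omega> \<in> V \<inter> D -` (- {0})"
    using V(2) simple_eigenvalue_pderiv_nonzero[OF herm simple] by (simp add: D_def L_def)
  moreover have "cont_diff_on k (\<lambda>x. Re (L x)) (V \<inter> D -` (- {0}))" (is "cont_diff_on k _ ?U")
  proof (rule cont_diff_on_bounded_linear[OF bounded_linear_Re \<open>open ?U\<close> cont_diff_on_root[OF \<open>open ?U\<close> _ _ root]])
    show "poly_cont_diff_on k (\<lambda>x. charpoly (A x)) ?U"
      using char by (auto simp: poly_cont_diff_on_def intro: cont_diff_on_subset)
    show "continuous_on ?U L" using L by (rule continuous_on_subset) auto
  qed (auto simp: D_def)
  ultimately show ?thesis by (intro that[of ?U]) (auto simp: L_def)
qed

subsection \<open>Comparison of the Hessians\<close>

lemma partial_derivative_diff: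
  assumes "f differentiable (at x)" "g differentiable (at x)"
  shows "partial_derivative i (\<lambda>x. f x - g x) x = partial_derivative i f x - partial_derivative i g x"
proof -
  obtain f' g' where "(f has_derivative f') (at x)" "(g has_derivative g') (at x)"
    using assms by (auto simp: differentiable_def)
  then show ?thesis
    using partial_derivative_eq[OF has_derivative_diff] by (simp add: partial_derivative_eq)
qed

lemma hessian_diff:
  assumes U: "open U" "x \<in> U" and f: "cont_diff_on 2 f U" and g: "cont_diff_on 2 g U"
  shows "hessian (\<lambda>x. f x - g x) x = hessian f x - hessian g x"
proof -
  have "partial_derivative k (partial_derivative l (\<lambda>x. f x - g x)) x =
      partial_derivative k (\<lambda>x. partial_derivative l f x - partial_derivative l g x) x" for k l
    by (rule partial_derivative_cong[OF U])
      (use f g in \<open>simp add: partial_derivative_diff numeral_2_eq_2\<close>)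
  also have "\<dots> k l = partial_derivative k (partial_derivative l f) x
      - partial_derivative k (partial_derivative l g) x" for k l
    by (rule partial_derivative_diff) (use U f g in \<open>simp_all add: numeral_2_eq_2\<close>)
  finally show ?thesis by (simp add: hessian_def vec_eq_iff)
qed

lemma hessian_symmetric:
  assumes "open U" "x \<in> U" "cont_diff_on 2 f U"
  shows "hessian f x $ k $ l = hessian f x $ l $ k"
  using partial_derivative_commute_real[OF assms(3,1,2)] by (simp add: hessian_def)

text \<open>The conjugate transpose exchanges blocks as well as positions within them. Positions are
  handled by the Hermitian symmetry of A, which survives differentiation, and blocks by the symmetry
  of mixed partials, applied to the real and imaginary part of each entry.\<close>

lemma hermitian_block_hessian:
  fixes A :: "real ^ 'd \<Rightarrow> complex ^ 'n ^ 'n"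
  assumes herm: "\<And>x. hermitian (A x)" and U: "open U" "x \<in> U" "cont_diff_on 2 A U"
  shows "hermitian (block_hessian A x)"
proof -
  let ?D = "\<lambda>k l. partial_derivative k (partial_derivative l A) x"
  have bl: "bounded_linear (\<lambda>M :: complex ^ 'n ^ 'n. M $ i $ j)" for i j
    by (intro bounded_linear_compose[OF bounded_linear_vec_nth bounded_linear_vec_nth])
  have commute: "T (?D k l) = T (?D l k)" if "bounded_linear T" for T :: "_ \<Rightarrow> real" and k l
    using partial_derivative_commute_real[OF cont_diff_on_bounded_linear[OF that U(1,3)] U(1,2)]
    by (simp add: partial_derivative2_bounded_linear[OF that U(1,3,2)])
  have sym: "?D k l $ i $ j = ?D l k $ i $ j" for k l i j
    using commute[OF bounded_linear_compose[OF bounded_linear_Re bl]]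
      commute[OF bounded_linear_compose[OF bounded_linear_Im bl]]
    by (simp add: complex_eq_iff)
  have conj: "?D k l $ i $ j = cnj (?D k l $ j $ i)" for k l i j
  proof -
    have "?D k l $ i $ j = partial_derivative k (partial_derivative l (\<lambda>x. A x $ i $ j)) x"
      by (simp add: partial_derivative2_bounded_linear[OF bl U(1,3,2)])
    also have "(\<lambda>x. A x $ i $ j) = (\<lambda>x. cnj (A x $ j $ i))"
      using herm unfolding hermitian_def by blast
    also have "partial_derivative k (partial_derivative l \<dots>) x = cnj (?D k l $ j $ i)"
      by (rule partial_derivative2_bounded_linear[OF bounded_linear_compose[OF bounded_linear_cnj bl] U(1,3,2)])
    finally show ?thesis .
  qed
  have swap: "?D k l $ i $ j = cnj (?D l k $ j $ i)" for k l i j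
    using conj[of k l i j] unfolding sym[of k l j i] .
  show ?thesis unfolding hermitian_def block_hessian_def vec_lambda_beta by (intro allI swap)
qed

text \<open>The vector \<open>w\<close> is the Kronecker product of \<open>h\<close> and \<open>v\<close>.\<close>

lemma block_hessian_quadratic_form:
  fixes A :: "real ^ 'd \<Rightarrow> complex ^ 'n ^ 'n"
  defines "w h v \<equiv> (\<chi> p. h $ fst p *\<^sub>R v $ snd p)"
  assumes U: "open U" "x \<in> U" "cont_diff_on 2 A U"
  shows "(\<Sum>k\<in>UNIV. \<Sum>l\<in>UNIV. h $ k * h $ l * hessian (\<lambda>x. (A x *v v) \<bullet> v) x $ k $ l)
    = (block_hessian A x *v w h v) \<bullet> w h v"
    and "w h v \<bullet> w h v = (h \<bullet> h) * (v \<bullet> v)"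
proof -
  let ?D = "\<lambda>k l. partial_derivative k (partial_derivative l A) x"
  have "(block_hessian A x *v w h v) \<bullet> w h v =
      (\<Sum>k\<in>UNIV. \<Sum>i\<in>UNIV. (\<Sum>l\<in>UNIV. \<Sum>j\<in>UNIV. ?D k l $ i $ j * (h $ l *\<^sub>R v $ j)) \<bullet> (h $ k *\<^sub>R v $ i))"
    by (simp add: inner_vec_def matrix_vector_mult_def block_hessian_def w_def sum.cartesian_product
        case_prod_unfold UNIV_Times_UNIV)
  also have "\<dots> = (\<Sum>k\<in>UNIV. \<Sum>l\<in>UNIV. \<Sum>i\<in>UNIV. (\<Sum>j\<in>UNIV. ?D k l $ i $ j * (h $ l *\<^sub>R v $ j)) \<bullet> (h $ k *\<^sub>R v $ i))"
    unfolding inner_sum_left[of _ UNIV] by (intro sum.cong refl sum.swap)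
  also have "\<dots> = (\<Sum>k\<in>UNIV. \<Sum>l\<in>UNIV. h $ k * h $ l * ((?D k l *v v) \<bullet> v))"
    by (simp add: inner_vec_def matrix_vector_mult_def sum_distrib_left inner_sum_left mult_ac)
  also have "\<dots> = (\<Sum>k\<in>UNIV. \<Sum>l\<in>UNIV. h $ k * h $ l * hessian (\<lambda>x. (A x *v v) \<bullet> v) x $ k $ l)"
    by (simp add: hessian_def partial_derivative2_bounded_linear[OF bounded_linear_quadratic_form U(1,3,2)])
  finally show "(\<Sum>k\<in>UNIV. \<Sum>l\<in>UNIV. h $ k * h $ l * hessian (\<lambda>x. (A x *v v) \<bullet> v) x $ k $ l)
    = (block_hessian A x *v w h v) \<bullet> w h v" ..
  have "w h v \<bullet> w h v = (\<Sum>k\<in>UNIV. \<Sum>i\<in>UNIV. (h $ k *\<^sub>R v $ i) \<bullet> (h $ k *\<^sub>R v $ i))"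
    by (simp add: inner_vec_def w_def sum.cartesian_product case_prod_unfold UNIV_Times_UNIV)
  also have "\<dots> = (h \<bullet> h) * (v \<bullet> v)"
    by (simp add: inner_vec_def sum_product mult_ac)
  finally show "w h v \<bullet> w h v = (h \<bullet> h) * (v \<bullet> v)" .
qed

theorem theorem5p1:
  fixes A :: "real ^ 'd \<Rightarrow> complex ^ 'n ^ 'n"
    and \<omega> :: "real ^ 'd"
  assumes "\<And>x. hermitian (A x)"
    and "real_analytic A"
    and "simple_eigenvalue (A \<omega>) (of_real (lambda_min (A \<omega>)))"
  shows "lambda_max (hessian (\<lambda>x. lambda_min (A x)) \<omega>) \<le> lambda_max (block_hessian A \<omega>)"
proof -
  let ?\<mu> = "\<lambda>x. lambda_min (A x)"
  let ?H = "hessian ?\<mu> \<omega>"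
  obtain V where V: "open V" "\<omega> \<in> V" "cont_diff_on 2 A V"
    using real_analytic_at_imp_cont_diff_on[of A \<omega>] assms(2) unfolding real_analytic_def by metis
  obtain U where U: "open U" "\<omega> \<in> U" "U \<subseteq> V" "cont_diff_on 2 ?\<mu> U"
    using lambda_min_cont_diff_on[OF assms(1) V assms(3)] by metis
  have AU: "cont_diff_on 2 A U" using cont_diff_on_subset[OF V(3) U(3)] .
  note sa = hermitian_selfadjoint[OF assms(1)]
  obtain v where v: "v \<noteq> 0" "A \<omega> *v v = ?\<mu> \<omega> *\<^sub>R v"
    using lambda_min_eigenvector[OF sa] by blast
  have vv: "v \<bullet> v > 0" using v(1) by simp
  \<comment> \<open>The symmetry of the Hessian guarantees that \<open>lambda_max ?H\<close> is
    attained as an eigenvalue with a real eigenvector.\<close>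
  obtain h where h: "h \<noteq> 0" "?H *v h = lambda_max ?H *\<^sub>R h"
    using lambda_max_eigenvector[OF symmetric_selfadjoint[OF hessian_symmetric[OF U(1,2,4)]]] by blast
  define q where "q x = (A x *v v) \<bullet> v" for x
  \<comment> \<open>The factor \<open>v \<bullet> v\<close> replaces a normalisation of
    \<open>v\<close>; it cancels at the end together with \<open>h \<bullet> h\<close>.\<close>
  define m where "m x = (v \<bullet> v) *\<^sub>R ?\<mu> x" for x
  have m_eq: "m = (\<lambda>x. (v \<bullet> v) *\<^sub>R ?\<mu> x)" by (simp add: m_def fun_eq_iff)
  have q: "cont_diff_on 2 q U"
    unfolding q_def by (rule cont_diff_on_bounded_linear[OF bounded_linear_quadratic_form U(1) AU])
  have m: "cont_diff_on 2 m U"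
    unfolding m_def by (rule cont_diff_on_bounded_linear[OF bounded_linear_scaleR_right U(1,4)])
  have Hm: "hessian m \<omega> $ k $ l = (v \<bullet> v) * ?H $ k $ l" for k l
    using partial_derivative2_bounded_linear[OF bounded_linear_scaleR_right U(1,4,2)]
    by (simp add: m_eq hessian_def)
  have "0 \<le> (\<Sum>k\<in>UNIV. \<Sum>l\<in>UNIV. h $ k * h $ l * hessian (\<lambda>x. q x - m x) \<omega> $ k $ l)"
  proof (rule hessian_nonneg_at_min[OF _ U(1,2)])
    show "cont_diff_on 2 (\<lambda>x. q x - m x) U"
      using cont_diff_on_add[OF U(1) q cont_diff_on_bounded_linear[OF bounded_linear_minus[OF bounded_linear_ident] U(1) m]]
      by simp
    have "q \<omega> - m \<omega> = 0" by (simp add: q_def m_def v(2))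
    moreover have "q y - m y \<ge> 0" for y
      using lambda_min_rayleigh[OF sa, of y v] by (simp add: q_def m_def mult_ac)
    ultimately show "q \<omega> - m \<omega> \<le> q y - m y" for y by metis
  qed
  then have "(\<Sum>k\<in>UNIV. \<Sum>l\<in>UNIV. h $ k * h $ l * hessian m \<omega> $ k $ l)
      \<le> (\<Sum>k\<in>UNIV. \<Sum>l\<in>UNIV. h $ k * h $ l * hessian q \<omega> $ k $ l)"
    by (simp add: hessian_diff[OF U(1,2) q m] right_diff_distrib sum_subtractf)
  also have "(\<Sum>k\<in>UNIV. \<Sum>l\<in>UNIV. h $ k * h $ l * hessian m \<omega> $ k $ l) = (v \<bullet> v) * ((?H *v h) \<bullet> h)"
    by (simp add: Hm inner_vec_def matrix_vector_mult_def sum_distrib_left sum_distrib_right mult_ac)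
  also have "\<dots> = lambda_max ?H * ((h \<bullet> h) * (v \<bullet> v))"
    by (simp add: h(2))
  also have "(\<Sum>k\<in>UNIV. \<Sum>l\<in>UNIV. h $ k * h $ l * hessian q \<omega> $ k $ l)
      \<le> lambda_max (block_hessian A \<omega>) * ((h \<bullet> h) * (v \<bullet> v))"
    unfolding q_def block_hessian_quadratic_form(1)[OF U(1,2) AU] block_hessian_quadratic_form(2)[OF U(1,2) AU, symmetric]
    by (rule lambda_max_rayleigh[OF hermitian_selfadjoint[OF hermitian_block_hessian[OF assms(1) U(1,2) AU]]])
  finally show ?thesis using vv h(1) by simp
qed

end
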